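(* Let $n=1$, $D=\frac{1}{\imath}\frac{d}{dx}$ and $\mathcal{D}=\mathbb{C}[D]$. (i) $\mathcal{C}^\infty(\mathsf{T})[x]$ is an injective $\mathcal{D}$-module. For $a\in\mathbb{C}$, $a\notin\mathbb{Z}$, the map $D-a$ is bijective on $\mathcal{C}^\infty(\mathsf{T})[x]$. For $a\in\mathbb{Z}$ the kernel of $D-a$ on $\mathcal{C}^\infty(\mathsf{T})[x]$ is $\mathbb{C}e^{\imath ax}$. (ii) There is exactly one injective envelope of $\mathcal{C}^\infty(\mathsf{T})$ in $\mathcal{C}^\infty(\mathsf{T})[x]$, and it consists of the elements $\sum_{j\ge 0}f_jx^j$ (with $f_j\in\mathcal{C}^\infty(\mathsf{T})$, finitely many nonzero) such that $f_j$ has finite support for all $j\ge 1$. (iii) The same statements hold with $\mathcal{C}^\infty(\mathsf{PT})$ replacing $\mathcal{C}^\infty(\mathsf{T})$ and $\mathbb{Q}$ replacing $\mathbb{Z}$.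
   Context: $\mathcal{C}^\infty(\mathsf{T})$ is the space of smooth functions $\mathbb{R}\to\mathbb{C}$ that are periodic with respect to $2\pi\mathbb{Z}$; each is given by its Fourier series $\sum_{a\in\mathbb{Z}}c_ae^{\imath ax}$ with rapidly decreasing coefficients. $\mathcal{C}^\infty(\mathsf{PT})=\bigcup_{N\ge 1}\mathcal{C}^\infty(\mathbb{R}/2\pi N\mathbb{Z})$ is the space of smooth functions on $\mathbb{R}$ that are periodic with respect to $2\pi N\mathbb{Z}$ for some integer $N\ge 1$ depending on the function; each is given by its Fourier series $\sum_{a\in\frac1N\mathbb{Z}}c_ae^{\imath ax}$. The support of such a function is $\{a : c_a\ne 0\}$. The notation $[x]$ denotes the subalgebra of $\mathcal{C}^\infty(\mathbb{R})$ obtained by adjoining the coordinate function $x$; its elements are written uniquely as polynomials in $x$ with coefficients in $\mathcal{C}^\infty(\mathsf{T})$, respectively $\mathcal{C}^\infty(\mathsf{PT})$. "An injective envelope of $N$ in $E$", for $N\subset E$, means a submodule of $E$ containing $N$ which is injective and an essential extension of $N$. *)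

theory Defs
  imports "HOL-Analysis.Analysis" "HOL-Algebra.Module" "HOL-Algebra.Algebraic_Closure_Type"
begin

section \<open>Homomorphisms, injective modules and injective envelopes\<close>

definition mod_hom ::
  "('r, 'k) ring_scheme \<Rightarrow> ('r, 'a, 'l) module_scheme \<Rightarrow> ('r, 'b, 'm) module_scheme \<Rightarrow> ('a \<Rightarrow> 'b) set"
where
  "mod_hom R M N = {h \<in> carrier M \<rightarrow> carrier N.
     (\<forall>x\<in>carrier M. \<forall>y\<in>carrier M. h (x \<oplus>\<^bsub>M\<^esub> y) = h x \<oplus>\<^bsub>N\<^esub> h y) \<and>
     (\<forall>r\<in>carrier R. \<forall>x\<in>carrier M. h (r \<odot>\<^bsub>M\<^esub> x) = r \<odot>\<^bsub>N\<^esub> h x)}"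

text \<open>
  Homomorphisms into an injective module extend along every injective homomorphism
  \<open>i : V \<rightarrow> W\<close>. A definition in HOL cannot quantify over types, so the test modules \<open>V\<close>, \<open>W\<close> have
  carriers in the type \<open>'r + 'u\<close>, where \<open>'r\<close> is the type of the ring and \<open>'u\<close> is a parameter.
  A statement that is polymorphic in \<open>'u\<close> covers all test modules. Conversely, as \<open>'r + 'u\<close> always
  has room for the ring and its ideals, by Baer's criterion the property is the usual injectivity
  for each single choice of \<open>'u\<close>; so it is also safe as a hypothesis.
\<close>

definition injective_module ::
  "'u itself \<Rightarrow> ('r, 'k) ring_scheme \<Rightarrow> ('r, 'm, 'l) module_scheme \<Rightarrow> bool"
where
  "injective_module (U :: 'u itself) R M \<longleftrightarrow>
     Module.module R M \<and>
     (\<forall>(V :: ('r, 'r + 'u) module) (W :: ('r, 'r + 'u) module) i h.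
        Module.module R V \<and> Module.module R W \<and>
        i \<in> mod_hom R V W \<and> inj_on i (carrier V) \<and> h \<in> mod_hom R V M \<longrightarrow>
        (\<exists>k\<in>mod_hom R W M. \<forall>x\<in>carrier V. k (i x) = h x))"

definition essential_extension ::
  "('r, 'k) ring_scheme \<Rightarrow> 'm set \<Rightarrow> ('r, 'm, 'l) module_scheme \<Rightarrow> bool"
where
  "essential_extension R N M \<longleftrightarrow>
     submodule N R M \<and>
     (\<forall>K. submodule K R M \<and> K \<noteq> {\<zero>\<^bsub>M\<^esub>} \<longrightarrow> K \<inter> N \<noteq> {\<zero>\<^bsub>M\<^esub>})"

definition injective_envelope_in ::
  "'u itself \<Rightarrow> ('r, 'k) ring_scheme \<Rightarrow> 'm set \<Rightarrow> ('r, 'm, 'l) module_scheme \<Rightarrow> 'm set \<Rightarrow> bool"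
where
  "injective_envelope_in U R N E H \<longleftrightarrow>
     submodule H R E \<and> N \<subseteq> H \<and>
     injective_module U R (E\<lparr>carrier := H\<rparr>) \<and>
     essential_extension R N (E\<lparr>carrier := H\<rparr>)"


section \<open>Smooth periodic functions\<close>

definition D_op :: "(real \<Rightarrow> complex) \<Rightarrow> real \<Rightarrow> complex" where
  "D_op f = (\<lambda>x. vector_derivative f (at x) / \<i>)"

definition smooth :: "(real \<Rightarrow> complex) \<Rightarrow> bool" where
  "smooth f \<longleftrightarrow> (\<forall>n x. ((\<lambda>g t. vector_derivative g (at t)) ^^ n) f differentiable (at x))"

definition Cinf_period :: "nat \<Rightarrow> (real \<Rightarrow> complex) set" where
  "Cinf_period N = {f. smooth f \<and> (\<forall>x. f (x + 2 * pi * real N) = f x)}"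

definition Cinf_T :: "(real \<Rightarrow> complex) set" where
  "Cinf_T = Cinf_period 1"

definition Cinf_PT :: "(real \<Rightarrow> complex) set" where
  "Cinf_PT = (\<Union>N\<in>{1..}. Cinf_period N)"

text \<open>The coefficient of \<open>exp (\<i> a x)\<close> in the Fourier series of a function with period
  \<open>2 \<pi> N\<close>, for \<open>a \<in> (1/N) \<int>\<close>.\<close>

definition fourier_coeff :: "nat \<Rightarrow> (real \<Rightarrow> complex) \<Rightarrow> real \<Rightarrow> complex" where
  "fourier_coeff N f a =
     integral {0..2 * pi * real N} (\<lambda>x. f x * exp (- \<i> * of_real a * of_real x))
       / of_real (2 * pi * real N)"

text \<open>The choice of the period \<open>2 \<pi> N\<close> is immaterial: passing to a multiple of \<open>N\<close> does not change
  the coefficients at \<open>a \<in> (1/N) \<int>\<close>, and the additional ones vanish. In particular the support of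
  an element of \<open>Cinf_T\<close> is the set of integers at which its usual Fourier coefficient is nonzero.\<close>

definition fourier_support :: "(real \<Rightarrow> complex) \<Rightarrow> real set" where
  "fourier_support f =
     {a. \<exists>N\<ge>1. f \<in> Cinf_period N \<and> real N * a \<in> \<int> \<and> fourier_coeff N f a \<noteq> 0}"

definition adjoin_x :: "(real \<Rightarrow> complex) set \<Rightarrow> (real \<Rightarrow> complex) set" where
  "adjoin_x A =
     {g. \<exists>n f. (\<forall>j\<le>n. f j \<in> A) \<and> g = (\<lambda>x. \<Sum>j\<le>n. f j x * of_real x ^ j)}"

definition adjoin_x_fin :: "(real \<Rightarrow> complex) set \<Rightarrow> (real \<Rightarrow> complex) set" where
  "adjoin_x_fin A =
     {g. \<exists>n f. (\<forall>j\<le>n. f j \<in> A) \<and> (\<forall>j\<in>{1..n}. finite (fourier_support (f j))) \<and>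
           g = (\<lambda>x. \<Sum>j\<le>n. f j x * of_real x ^ j)}"


section \<open>Function spaces as modules over \<open>\<complex>[D]\<close>\<close>

text \<open>The operator \<open>D\<close> is transcendental over \<open>\<complex>\<close>, so \<open>\<complex>[D]\<close> is the polynomial ring, with \<open>p\<close>
  acting as the differential operator \<open>p(D)\<close>.\<close>

abbreviation CD :: "complex poly ring" where
  "CD \<equiv> ring_of_type_algebra"

text \<open>The fields \<open>mult\<close> and \<open>one\<close> are present in every module record but play no role for modules.\<close>

definition fun_module :: "(real \<Rightarrow> complex) set \<Rightarrow> (complex poly, real \<Rightarrow> complex) module" where
  "fun_module A =
     \<lparr>carrier = A, monoid.mult = (\<lambda>f g x. f x * g x), one = (\<lambda>x. 1),
      ring.zero = (\<lambda>x. 0), add = (\<lambda>f g x. f x + g x),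
      smult = (\<lambda>p f x. \<Sum>j\<le>Polynomial.degree p. Polynomial.coeff p j * (D_op ^^ j) f x)\<rparr>"

end

theory Submission
  imports Defs
begin

text \<open>
  Let \<open>A\<close> be the algebra of periodic functions and \<open>E = A[x]\<close>. Over the principal ideal domain
  \<open>\<complex>[D]\<close> a module is injective iff it is divisible, and by factoring polynomials this only concerns
  the operators \<open>D - a\<close>. A solution of \<open>(D - a) h = f\<close> with \<open>f\<close> periodic is periodic up to a multiple of
  \<open>exp (\<i> a x)\<close> or \<open>x exp (\<i> a x)\<close>, and induction on the degree in \<open>x\<close> shows that \<open>E\<close> is divisible.
  All kernels of \<open>D - a\<close> on \<open>E\<close> lie in \<open>A\<close>. Hence \<open>E / H\<close> is torsion-free for every divisible \<open>H\<close>
  between \<open>A\<close> and \<open>E\<close>, and the only injective envelope of \<open>A\<close> in \<open>E\<close> is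
  \<open>{g \<in> E. p(D) g \<in> A for some p \<noteq> 0}\<close>. Looking at top coefficients, \<open>g\<close> belongs to it iff each of
  its coefficients of positive degree is annihilated by some \<open>p(D)\<close> with \<open>p \<noteq> 0\<close>. Since \<open>p(D)\<close> multiplies the
  Fourier coefficient at \<open>a\<close> by \<open>p(a)\<close>, and Fourier coefficients determine the function, this means
  that the coefficient has finite support.
\<close>

section \<open>Divisible modules and injectivity\<close>

text \<open>Injective envelopes inside a given module are in general unique only up to isomorphism.
  Uniqueness as a subset comes from the kernels: \<open>E\<close> has no eigenfunction of D outside
  \<open>A\<close>, so two solutions in \<open>E\<close> of (D - a) u = v differ by an element of
  every candidate envelope. Adjoining \<open>x\<close> is forced by resonance: if exp(i a x) is
  itself periodic, it has no periodic preimage under D - a, and a multiple of x exp(i a x) supplies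
  one.

  Elements of \<open>A[x]\<close> are functions, not formal polynomials, so comparing top
  coefficients needs an argument: along an arithmetic progression of periods the coefficients are
  constant, and a genuine polynomial with infinitely many zeros remains. For PT the coefficients
  must first be given a common period; sets of periods closed under products provide it and allow T
  and PT to be treated at once. Fourier uniqueness comes from Stone-Weierstrass; no series is ever
  summed.\<close>

definition divisible_module :: "('r, 'k) ring_scheme \<Rightarrow> ('r, 'm, 'l) module_scheme \<Rightarrow> bool" where
  "divisible_module R M \<longleftrightarrow>
     (\<forall>r\<in>carrier R - {\<zero>\<^bsub>R\<^esub>}. \<forall>m\<in>carrier M. \<exists>m'\<in>carrier M. r \<odot>\<^bsub>M\<^esub> m' = m)"

text \<open>Partial homomorphisms from \<open>W\<close> to \<open>M\<close>, encoded as sets of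
  pairs: extension becomes inclusion, so that Zorn's lemma for sets applies directly.\<close>

definition submodule_graph ::
  "('r, 'k) ring_scheme \<Rightarrow> ('r, 'w, 'l) module_scheme \<Rightarrow> ('r, 'm, 'l2) module_scheme \<Rightarrow> ('w \<times> 'm) set \<Rightarrow> bool"
where
  "submodule_graph R W M G \<longleftrightarrow>
     G \<subseteq> carrier W \<times> carrier M \<and>
     (\<forall>w m w' m'. (w, m) \<in> G \<longrightarrow> (w', m') \<in> G \<longrightarrow> (w \<oplus>\<^bsub>W\<^esub> w', m \<oplus>\<^bsub>M\<^esub> m') \<in> G) \<and>
     (\<forall>r\<in>carrier R. \<forall>w m. (w, m) \<in> G \<longrightarrow> (r \<odot>\<^bsub>W\<^esub> w, r \<odot>\<^bsub>M\<^esub> m) \<in> G) \<and>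
     (\<forall>w m m'. (w, m) \<in> G \<longrightarrow> (w, m') \<in> G \<longrightarrow> m = m')"

lemma submodule_graphD:
  assumes "submodule_graph R W M G"
  shows "(w, m) \<in> G \<Longrightarrow> w \<in> carrier W"
    and "(w, m) \<in> G \<Longrightarrow> m \<in> carrier M"
    and "(w, m) \<in> G \<Longrightarrow> (w', m') \<in> G \<Longrightarrow> (w \<oplus>\<^bsub>W\<^esub> w', m \<oplus>\<^bsub>M\<^esub> m') \<in> G"
    and "r \<in> carrier R \<Longrightarrow> (w, m) \<in> G \<Longrightarrow> (r \<odot>\<^bsub>W\<^esub> w, r \<odot>\<^bsub>M\<^esub> m) \<in> G"
    and "(w, m) \<in> G \<Longrightarrow> (w, m') \<in> G \<Longrightarrow> m = m'"
  using assms unfolding submodule_graph_def by blast+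

text \<open>Each closure condition involves at most two pairs, and any two pairs of the union
  already lie in a common member of the chain.\<close>

lemma submodule_graph_Union_chain:
  assumes "C \<noteq> {}" and chain: "subset.chain {G. submodule_graph R W M G \<and> B \<subseteq> G} C"
  shows "submodule_graph R W M (\<Union>C) \<and> B \<subseteq> \<Union>C"
proof -
  have *: "submodule_graph R W M G" if "G \<in> C" for G
    using chain that by (auto simp: subset.chain_def)
  have B: "B \<subseteq> G" if "G \<in> C" for G
    using chain that by (auto simp: subset.chain_def)
  have directed: "\<exists>G\<in>C. p \<in> G \<and> q \<in> G" if "p \<in> \<Union>C" "q \<in> \<Union>C" for p q
    using chain that unfolding subset.chain_def by blast
  have "\<Union>C \<subseteq> carrier W \<times> carrier M"
    using * unfolding submodule_graph_def by blast
  moreover have "(w \<oplus>\<^bsub>W\<^esub> w', m \<oplus>\<^bsub>M\<^esub> m') \<in> \<Union>C" if "(w, m) \<in> \<Union>C" "(w', m') \<in> \<Union>C" for w m w' m'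
    using directed[OF that] submodule_graphD(3)[OF *] by blast
  moreover have "(r \<odot>\<^bsub>W\<^esub> w, r \<odot>\<^bsub>M\<^esub> m) \<in> \<Union>C" if "r \<in> carrier R" "(w, m) \<in> \<Union>C" for r w m
    using that submodule_graphD(4)[OF *] by blast
  moreover have "m = m'" if "(w, m) \<in> \<Union>C" "(w, m') \<in> \<Union>C" for w m m'
    using directed[OF that] submodule_graphD(5)[OF *] by blast
  ultimately have "submodule_graph R W M (\<Union>C)"
    unfolding submodule_graph_def by (intro conjI allI impI ballI)
  then show ?thesis using assms(1) B by blast
qed

text \<open>The multipliers \<open>r\<close> with \<open>r \<odot> w\<close> in the domain form an ideal \<open>(a)\<close>;
  any \<open>m\<close> with \<open>a \<odot> m\<close> equal to the prescribed value at \<open>a \<odot> w\<close> is a consistent value at \<open>w\<close>.\<close>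

lemma submodule_graph_extend:
  assumes "principal_domain R" "Module.module R W" "Module.module R M" "divisible_module R M"
    and G: "submodule_graph R W M G" "(\<zero>\<^bsub>W\<^esub>, \<zero>\<^bsub>M\<^esub>) \<in> G" and w: "w \<in> carrier W"
  shows "\<exists>G'. submodule_graph R W M G' \<and> G \<subseteq> G' \<and> w \<in> Domain G'"
proof -
  interpret R: principal_domain R by fact
  interpret W: Module.module R W by fact
  interpret M: Module.module R M by fact
  note GD = submodule_graphD[OF G(1)]
  define I where "I = {r \<in> carrier R. \<exists>m. (r \<odot>\<^bsub>W\<^esub> w, m) \<in> G}"
  have "ideal I R"
  proof (rule idealI)
    show "ring R" by (rule R.ring_axioms)
    show "subgroup I (add_monoid R)"
    proof (rule R.add.subgroupI)
      show "I \<subseteq> carrier R" by (auto simp: I_def)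
      show "I \<noteq> {}" using G(2) w by (auto simp: I_def intro!: exI[of _ "\<zero>\<^bsub>R\<^esub>"])
      show "\<ominus>\<^bsub>R\<^esub> a \<in> I" if aI: "a \<in> I" for a
      proof -
        obtain m where "a \<in> carrier R" "(a \<odot>\<^bsub>W\<^esub> w, m) \<in> G" using aI unfolding I_def by blast
        \<comment> \<open>Graphs are closed under sums and scalars only, so negatives arise from the
          scalar -1.\<close>
        then have "((\<ominus>\<^bsub>R\<^esub> \<one>\<^bsub>R\<^esub>) \<odot>\<^bsub>W\<^esub> (a \<odot>\<^bsub>W\<^esub> w), (\<ominus>\<^bsub>R\<^esub> \<one>\<^bsub>R\<^esub>) \<odot>\<^bsub>M\<^esub> m) \<in> G"
          by (intro GD) auto
        moreover have "(\<ominus>\<^bsub>R\<^esub> \<one>\<^bsub>R\<^esub>) \<odot>\<^bsub>W\<^esub> (a \<odot>\<^bsub>W\<^esub> w) = (\<ominus>\<^bsub>R\<^esub> a) \<odot>\<^bsub>W\<^esub> w"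
          using \<open>a \<in> carrier R\<close> w by (simp add: W.smult_l_minus)
        ultimately show ?thesis using \<open>a \<in> carrier R\<close> by (auto simp: I_def)
      qed
      show "a \<oplus>\<^bsub>R\<^esub> b \<in> I" if "a \<in> I" "b \<in> I" for a b
        using that GD(3) w by (fastforce simp: I_def W.smult_l_distr)
    qed
    show "x \<otimes>\<^bsub>R\<^esub> a \<in> I" if "a \<in> I" "x \<in> carrier R" for a x
      using that GD(4) w by (fastforce simp: I_def W.smult_assoc1)
    then show "a \<otimes>\<^bsub>R\<^esub> x \<in> I" if "a \<in> I" "x \<in> carrier R" for a x
      using that R.m_comm[of a x] by (auto simp: I_def)
  qed
  then obtain a where a: "a \<in> carrier R" "I = PIdl\<^bsub>R\<^esub> a"
    using R.exists_gen by blast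
  have "a \<in> I" using a R.cgenideal_self by simp
  then obtain m0 where m0: "(a \<odot>\<^bsub>W\<^esub> w, m0) \<in> G" unfolding I_def by blast
  obtain m where m: "m \<in> carrier M" "a \<odot>\<^bsub>M\<^esub> m = m0"
  \<comment> \<open>Divisibility says nothing about division by 0. If \<open>a = 0\<close>, the
    prescribed value \<open>m0\<close> sits over 0, hence is 0, and \<open>m = 0\<close>
    serves.\<close>
  proof (cases "a = \<zero>\<^bsub>R\<^esub>")
    case True
    then have "m0 = \<zero>\<^bsub>M\<^esub>" using m0 G(2) w GD(5) by simp
    then show ?thesis using that[of "\<zero>\<^bsub>M\<^esub>"] True by simp
  next
    case False
    then show ?thesis using assms(4) a(1) GD(2)[OF m0] that unfolding divisible_module_def by blast
  qed
  have I_val: "(r \<odot>\<^bsub>W\<^esub> w, r \<odot>\<^bsub>M\<^esub> m) \<in> G" if rI: "r \<in> I" for r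
  proof -
    obtain t where t: "t \<in> carrier R" "r = t \<otimes>\<^bsub>R\<^esub> a"
      using rI a(2) by (auto simp: cgenideal_def)
    show ?thesis using GD(4)[OF t(1) m0] t a m w
      by (simp add: W.smult_assoc1 M.smult_assoc1)
  qed
  \<comment> \<open>The sum of \<open>G\<close> and the cyclic module generated by
    \<open>(w, m)\<close>.\<close>
  define G' where "G' = {(u \<oplus>\<^bsub>W\<^esub> r \<odot>\<^bsub>W\<^esub> w, v \<oplus>\<^bsub>M\<^esub> r \<odot>\<^bsub>M\<^esub> m) | u v r. (u, v) \<in> G \<and> r \<in> carrier R}"
  have unique: "y = y'" if "(x, y) \<in> G'" "(x, y') \<in> G'" for x y y'
  proof -
    obtain u v r where 1: "(u, v) \<in> G" "r \<in> carrier R" "x = u \<oplus>\<^bsub>W\<^esub> r \<odot>\<^bsub>W\<^esub> w" "y = v \<oplus>\<^bsub>M\<^esub> r \<odot>\<^bsub>M\<^esub> m"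
      using \<open>(x, y) \<in> G'\<close> unfolding G'_def by blast
    obtain u' v' r' where 2: "(u', v') \<in> G" "r' \<in> carrier R" "x = u' \<oplus>\<^bsub>W\<^esub> r' \<odot>\<^bsub>W\<^esub> w" "y' = v' \<oplus>\<^bsub>M\<^esub> r' \<odot>\<^bsub>M\<^esub> m"
      using \<open>(x, y') \<in> G'\<close> unfolding G'_def by blast
    note carr = GD(1,2)[OF 1(1)] GD(1,2)[OF 2(1)] 1(2) 2(2) w m(1)
    \<comment> \<open>Two representations of the same \<open>x\<close> differ by \<open>s\<close>
      times \<open>w\<close>, which lies in the domain of \<open>G\<close>. Hence \<open>s\<close>
      is in \<open>I\<close>, and \<open>I_val\<close> shows that \<open>G\<close> already assigns
      \<open>s\<close> times \<open>m\<close> there.\<close>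
    define s where "s = r' \<ominus>\<^bsub>R\<^esub> r"
    have s: "s \<in> carrier R" using carr by (simp add: s_def)
    have r': "r' = r \<oplus>\<^bsub>R\<^esub> s"
      using carr by (simp add: s_def R.minus_eq R.a_lcomm R.r_neg)
    have "u' \<oplus>\<^bsub>W\<^esub> (s \<odot>\<^bsub>W\<^esub> w \<oplus>\<^bsub>W\<^esub> r \<odot>\<^bsub>W\<^esub> w) = u \<oplus>\<^bsub>W\<^esub> r \<odot>\<^bsub>W\<^esub> w"
      using 1(3) 2(3) carr s by (simp add: r' W.smult_l_distr W.a_ac)
    then have "u' \<oplus>\<^bsub>W\<^esub> s \<odot>\<^bsub>W\<^esub> w = u"
      using carr s by (simp flip: W.a_assoc)
    moreover have "s \<odot>\<^bsub>W\<^esub> w = u \<oplus>\<^bsub>W\<^esub> (\<ominus>\<^bsub>R\<^esub> \<one>\<^bsub>R\<^esub>) \<odot>\<^bsub>W\<^esub> u'"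
      using calculation[symmetric] carr s by (simp add: W.smult_l_minus W.a_ac W.r_neg2)
    moreover have "(u \<oplus>\<^bsub>W\<^esub> (\<ominus>\<^bsub>R\<^esub> \<one>\<^bsub>R\<^esub>) \<odot>\<^bsub>W\<^esub> u', v \<oplus>\<^bsub>M\<^esub> (\<ominus>\<^bsub>R\<^esub> \<one>\<^bsub>R\<^esub>) \<odot>\<^bsub>M\<^esub> v') \<in> G"
      using 1(1) 2(1) by (intro GD(3,4)) auto
    ultimately have "s \<in> I" using s by (auto simp: I_def)
    then have "(u, v' \<oplus>\<^bsub>M\<^esub> s \<odot>\<^bsub>M\<^esub> m) \<in> G"
      using GD(3)[OF 2(1) I_val] \<open>u' \<oplus>\<^bsub>W\<^esub> s \<odot>\<^bsub>W\<^esub> w = u\<close> by auto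
    then have "v = v' \<oplus>\<^bsub>M\<^esub> s \<odot>\<^bsub>M\<^esub> m" using 1(1) GD(5) by blast
    then show ?thesis using carr s 1(4) 2(4) by (simp add: r' M.smult_l_distr M.a_ac)
  qed
  have "submodule_graph R W M G'"
    unfolding submodule_graph_def
  proof (intro conjI allI impI ballI)
    show "G' \<subseteq> carrier W \<times> carrier M" using GD(1,2) w m by (auto simp: G'_def)
    show "y = y'" if "(x, y) \<in> G'" "(x, y') \<in> G'" for x y y' by (rule unique[OF that])
    show "(x \<oplus>\<^bsub>W\<^esub> x', y \<oplus>\<^bsub>M\<^esub> y') \<in> G'" if xy: "(x, y) \<in> G'" "(x', y') \<in> G'" for x y x' y'
    proof -
      obtain u v r where 1: "(u, v) \<in> G" "r \<in> carrier R" "x = u \<oplus>\<^bsub>W\<^esub> r \<odot>\<^bsub>W\<^esub> w" "y = v \<oplus>\<^bsub>M\<^esub> r \<odot>\<^bsub>M\<^esub> m"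
        using xy(1) unfolding G'_def by blast
      obtain u' v' r' where 2: "(u', v') \<in> G" "r' \<in> carrier R" "x' = u' \<oplus>\<^bsub>W\<^esub> r' \<odot>\<^bsub>W\<^esub> w" "y' = v' \<oplus>\<^bsub>M\<^esub> r' \<odot>\<^bsub>M\<^esub> m"
        using xy(2) unfolding G'_def by blast
      note carr = GD(1,2)[OF 1(1)] GD(1,2)[OF 2(1)] 1(2) 2(2) w m(1)
      have "x \<oplus>\<^bsub>W\<^esub> x' = (u \<oplus>\<^bsub>W\<^esub> u') \<oplus>\<^bsub>W\<^esub> (r \<oplus>\<^bsub>R\<^esub> r') \<odot>\<^bsub>W\<^esub> w"
        using carr 1 2 by (simp add: W.smult_l_distr W.a_ac)
      moreover have "y \<oplus>\<^bsub>M\<^esub> y' = (v \<oplus>\<^bsub>M\<^esub> v') \<oplus>\<^bsub>M\<^esub> (r \<oplus>\<^bsub>R\<^esub> r') \<odot>\<^bsub>M\<^esub> m"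
        using carr 1 2 by (simp add: M.smult_l_distr M.a_ac)
      ultimately show ?thesis
        unfolding G'_def using GD(3)[OF 1(1) 2(1)] R.a_closed[OF 1(2) 2(2)] by blast
    qed
    show "(c \<odot>\<^bsub>W\<^esub> x, c \<odot>\<^bsub>M\<^esub> y) \<in> G'" if c: "c \<in> carrier R" and xy: "(x, y) \<in> G'" for c x y
    proof -
      obtain u v r where 1: "(u, v) \<in> G" "r \<in> carrier R" "x = u \<oplus>\<^bsub>W\<^esub> r \<odot>\<^bsub>W\<^esub> w" "y = v \<oplus>\<^bsub>M\<^esub> r \<odot>\<^bsub>M\<^esub> m"
        using xy(1) unfolding G'_def by blast
      note carr = GD(1,2)[OF 1(1)] 1(2) w m(1) c
      have "c \<odot>\<^bsub>W\<^esub> x = (c \<odot>\<^bsub>W\<^esub> u) \<oplus>\<^bsub>W\<^esub> (c \<otimes>\<^bsub>R\<^esub> r) \<odot>\<^bsub>W\<^esub> w"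
        using carr 1 by (simp add: W.smult_r_distr W.smult_assoc1)
      moreover have "c \<odot>\<^bsub>M\<^esub> y = (c \<odot>\<^bsub>M\<^esub> v) \<oplus>\<^bsub>M\<^esub> (c \<otimes>\<^bsub>R\<^esub> r) \<odot>\<^bsub>M\<^esub> m"
        using carr 1 by (simp add: M.smult_r_distr M.smult_assoc1)
      ultimately show ?thesis
        unfolding G'_def using GD(4)[OF c 1(1)] R.m_closed[OF c 1(2)] by blast
    qed
  qed
  moreover have "G \<subseteq> G'"
  proof
    fix p assume "p \<in> G"
    then obtain u v where "p = (u, v)" "(u, v) \<in> G" by (cases p) auto
    moreover have "(u, v) = (u \<oplus>\<^bsub>W\<^esub> \<zero>\<^bsub>R\<^esub> \<odot>\<^bsub>W\<^esub> w, v \<oplus>\<^bsub>M\<^esub> \<zero>\<^bsub>R\<^esub> \<odot>\<^bsub>M\<^esub> m)"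
      using GD(1,2)[OF calculation(2)] w m by simp
    ultimately show "p \<in> G'" unfolding G'_def using R.zero_closed by blast
  qed
  moreover have "w \<in> Domain G'"
  proof -
    have "(\<zero>\<^bsub>W\<^esub> \<oplus>\<^bsub>W\<^esub> \<one>\<^bsub>R\<^esub> \<odot>\<^bsub>W\<^esub> w, \<zero>\<^bsub>M\<^esub> \<oplus>\<^bsub>M\<^esub> \<one>\<^bsub>R\<^esub> \<odot>\<^bsub>M\<^esub> m) \<in> G'"
      unfolding G'_def using G(2) R.one_closed by blast
    then show ?thesis using w by auto
  qed
  ultimately show ?thesis by blast
qed

section \<open>Extension of homomorphisms into divisible modules, and the converse\<close>

lemma mod_homD:
  assumes "h \<in> mod_hom R M N"
  shows "x \<in> carrier M \<Longrightarrow> h x \<in> carrier N"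
    and "x \<in> carrier M \<Longrightarrow> y \<in> carrier M \<Longrightarrow> h (x \<oplus>\<^bsub>M\<^esub> y) = h x \<oplus>\<^bsub>N\<^esub> h y"
    and "r \<in> carrier R \<Longrightarrow> x \<in> carrier M \<Longrightarrow> h (r \<odot>\<^bsub>M\<^esub> x) = r \<odot>\<^bsub>N\<^esub> h x"
  using assms by (auto simp: mod_hom_def)

text \<open>Zorn's lemma on the partial homomorphisms that extend \<open>h\<close> transported along
  \<open>i\<close>. A maximal one is defined everywhere, since otherwise
  \<open>submodule_graph_extend\<close> would enlarge it.\<close>

lemma mod_hom_extend:
  assumes R: "principal_domain R" and V: "Module.module R V" and W: "Module.module R W"
    and M: "Module.module R M" and div: "divisible_module R M"
    and i: "i \<in> mod_hom R V W" "inj_on i (carrier V)" and h: "h \<in> mod_hom R V M"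
  shows "\<exists>k\<in>mod_hom R W M. \<forall>x\<in>carrier V. k (i x) = h x"
proof -
  interpret R: principal_domain R by fact
  interpret V: Module.module R V by fact
  interpret W: Module.module R W by fact
  interpret M: Module.module R M by fact
  \<comment> \<open>Single-valued because \<open>i\<close> is injective.\<close>
  define G0 where "G0 = (\<lambda>v. (i v, h v)) ` carrier V"
  note iD = mod_homD[OF i(1)] and hD = mod_homD[OF h]
  have G0: "submodule_graph R W M G0"
    unfolding submodule_graph_def
  proof (intro conjI allI impI ballI)
    show "G0 \<subseteq> carrier W \<times> carrier M" using iD hD by (auto simp: G0_def)
    show "(w \<oplus>\<^bsub>W\<^esub> w', m \<oplus>\<^bsub>M\<^esub> m') \<in> G0" if wm: "(w, m) \<in> G0" "(w', m') \<in> G0" for w m w' m'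
    proof -
      obtain v v' where "v \<in> carrier V" "v' \<in> carrier V" "w = i v" "w' = i v'" "m = h v" "m' = h v'"
        using wm unfolding G0_def by blast
      then show ?thesis using iD hD by (auto simp: G0_def intro!: image_eqI[of _ _ "v \<oplus>\<^bsub>V\<^esub> v'"])
    qed
    show "(r \<odot>\<^bsub>W\<^esub> w, r \<odot>\<^bsub>M\<^esub> m) \<in> G0" if r: "r \<in> carrier R" and wm: "(w, m) \<in> G0" for r w m
    proof -
      obtain v where "v \<in> carrier V" "w = i v" "m = h v"
        using wm unfolding G0_def by blast
      then show ?thesis using iD hD r by (auto simp: G0_def intro!: image_eqI[of _ _ "r \<odot>\<^bsub>V\<^esub> v"])
    qed
    show "m = m'" if "(w, m) \<in> G0" "(w, m') \<in> G0" for w m m'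
      using that i(2) by (auto simp: G0_def inj_on_def)
  qed
  define \<A> where "\<A> = {G. submodule_graph R W M G \<and> G0 \<subseteq> G}"
  have "\<exists>G\<in>\<A>. \<forall>Y\<in>\<A>. G \<subseteq> Y \<longrightarrow> Y = G"
  proof (rule subset_Zorn_nonempty)
    show "\<A> \<noteq> {}" using G0 by (auto simp: \<A>_def)
    show "\<Union>C \<in> \<A>" if "C \<noteq> {}" "subset.chain \<A> C" for C
      using submodule_graph_Union_chain[OF that[unfolded \<A>_def]] by (simp add: \<A>_def)
  qed
  then obtain G where G: "submodule_graph R W M G" "G0 \<subseteq> G"
    and max: "\<And>Y. submodule_graph R W M Y \<Longrightarrow> G \<subseteq> Y \<Longrightarrow> Y = G"
    unfolding \<A>_def by (smt (verit) mem_Collect_eq order_trans)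
  note GD = submodule_graphD[OF G(1)]
  have "(i \<zero>\<^bsub>V\<^esub>, h \<zero>\<^bsub>V\<^esub>) \<in> G" using G(2) by (auto simp: G0_def)
  \<comment> \<open>Scaling any pair by 0 yields the zero pair that
    \<open>submodule_graph_extend\<close> asks for.\<close>
  then have "(\<zero>\<^bsub>R\<^esub> \<odot>\<^bsub>W\<^esub> i \<zero>\<^bsub>V\<^esub>, \<zero>\<^bsub>R\<^esub> \<odot>\<^bsub>M\<^esub> h \<zero>\<^bsub>V\<^esub>) \<in> G" by (intro GD(4)) auto
  then have zero: "(\<zero>\<^bsub>W\<^esub>, \<zero>\<^bsub>M\<^esub>) \<in> G" using iD hD by simp
  have "\<exists>m. (w, m) \<in> G" if "w \<in> carrier W" for w
    using submodule_graph_extend[OF R W M div G(1) zero that] max by blast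
  then obtain k where k: "\<And>w. w \<in> carrier W \<Longrightarrow> (w, k w) \<in> G" by metis
  have k_eq: "k w = m" if "(w, m) \<in> G" for w m
    using GD(1,5) k that by blast
  have "k \<in> mod_hom R W M"
    unfolding mod_hom_def using k GD(2,3,4) by (auto intro!: k_eq)
  moreover have "k (i x) = h x" if "x \<in> carrier V" for x
    using G(2) that by (intro k_eq) (auto simp: G0_def)
  ultimately show ?thesis by blast
qed

lemma divisible_imp_injective_module:
  assumes "principal_domain R" "Module.module R M" "divisible_module R M"
  shows "injective_module U R M"
  unfolding injective_module_def using assms by (blast intro: mod_hom_extend)

text \<open>The test modules are two copies of \<open>R\<close>, embedded by multiplication with \<open>r\<close>.\<close>

lemma injective_imp_divisible_module:
  fixes R :: "('r, 'k) ring_scheme" and U :: "'u itself"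
  assumes "domain R" and inj: "injective_module U R M"
  shows "divisible_module R M"
  unfolding divisible_module_def
proof (intro ballI)
  fix r m assume r: "r \<in> carrier R - {\<zero>\<^bsub>R\<^esub>}" and m: "m \<in> carrier M"
  interpret R: domain R by fact
  interpret M: Module.module R M using inj by (simp add: injective_module_def)
  define V :: "('r, 'r + 'u) module" where "V = \<lparr>carrier = Inl ` carrier R, monoid.mult = (\<lambda>x y. x), one = Inl \<one>\<^bsub>R\<^esub>,
      ring.zero = Inl \<zero>\<^bsub>R\<^esub>, add = (\<lambda>x y. Inl (projl x \<oplus>\<^bsub>R\<^esub> projl y)),
      smult = (\<lambda>a x. Inl (a \<otimes>\<^bsub>R\<^esub> projl x))\<rparr>"
  have "Module.module R V"
  proof (rule moduleI)
    show "abelian_group V"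
    proof (rule abelian_groupI)
      show "\<exists>y\<in>carrier V. y \<oplus>\<^bsub>V\<^esub> x = \<zero>\<^bsub>V\<^esub>" if "x \<in> carrier V" for x
        using that by (auto simp: V_def R.l_neg intro!: bexI[of _ "\<ominus>\<^bsub>R\<^esub> _"])
    qed (auto simp: V_def R.a_ac)
  qed (auto simp: V_def R.l_distr R.r_distr R.m_assoc intro: R.is_cring)
  moreover define i where "i = (\<lambda>x :: 'r + 'u. Inl (r \<otimes>\<^bsub>R\<^esub> projl x) ::  'r + 'u)"
  moreover have "i \<in> mod_hom R V V"
    using r by (auto simp: mod_hom_def V_def i_def R.r_distr R.m_ac)
  moreover have "inj_on i (carrier V)"
    using r by (auto simp: inj_on_def V_def i_def R.m_lcancel)
  moreover define h where "h = (\<lambda>x ::  'r + 'u. projl x \<odot>\<^bsub>M\<^esub> m)"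
  moreover have "h \<in> mod_hom R V M"
    using m by (auto simp: mod_hom_def V_def h_def M.smult_l_distr M.smult_assoc1)
  ultimately obtain k where k: "k \<in> mod_hom R V M" "\<And>x. x \<in> carrier V \<Longrightarrow> k (i x) = h x"
    using inj unfolding injective_module_def by blast
  have one: "Inl \<one>\<^bsub>R\<^esub> \<in> carrier V" by (simp add: V_def)
  \<comment> \<open>The wanted quotient of \<open>m\<close> by \<open>r\<close> is the value of the
    extension at 1, because \<open>i\<close> sends 1 to \<open>r\<close> and \<open>h\<close> sends
    1 to \<open>m\<close>.\<close>
  have "r \<odot>\<^bsub>M\<^esub> k (Inl \<one>\<^bsub>R\<^esub>) = k (r \<odot>\<^bsub>V\<^esub> Inl \<one>\<^bsub>R\<^esub>)"
    using mod_homD(3)[OF k(1) _ one] r by simp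
  also have "r \<odot>\<^bsub>V\<^esub> Inl \<one>\<^bsub>R\<^esub> = i (Inl \<one>\<^bsub>R\<^esub>)" by (simp add: V_def i_def)
  also have "k \<dots> = m" using k(2)[OF one] m by (simp add: h_def)
  finally show "\<exists>m'\<in>carrier M. r \<odot>\<^bsub>M\<^esub> m' = m"
    using mod_homD(1)[OF k(1) one] by blast
qed

section \<open>Smooth functions\<close>

text \<open>Differentiability of order n + 1, with the derivative taken first. In this form sum and
  product rules go by induction on n with the functions kept arbitrary.\<close>

primrec n_diff :: "nat \<Rightarrow> (real \<Rightarrow> complex) \<Rightarrow> bool" where
  "n_diff 0 f \<longleftrightarrow> (\<forall>x. f differentiable at x)"
| "n_diff (Suc n) f \<longleftrightarrow>
     (\<forall>x. f differentiable at x) \<and> n_diff n (\<lambda>t. vector_derivative f (at t))"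

lemma n_diff_iff:
  "n_diff n f \<longleftrightarrow> (\<forall>m\<le>n. \<forall>x. ((\<lambda>g t. vector_derivative g (at t)) ^^ m) f differentiable at x)"
proof (induction n arbitrary: f)
  case 0
  then show ?case by simp
next
  case (Suc n)
  show ?case
    unfolding n_diff.simps Suc.IH
    by (auto simp: All_less_Suc2 less_Suc_eq_le[symmetric] funpow_Suc_right simp del: funpow.simps(2))
qed

lemma smooth_iff_n_diff: "smooth f \<longleftrightarrow> (\<forall>n. n_diff n f)"
  unfolding smooth_def n_diff_iff by auto

lemma n_diff_Suc_imp: "n_diff (Suc n) f \<Longrightarrow> n_diff n f"
  by (auto simp: n_diff_iff)

lemma n_diff_SucI:
  assumes "\<And>x. (f has_vector_derivative f' x) (at x)" "n_diff n f'"
  shows "n_diff (Suc n) f"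
proof -
  have "(\<lambda>t. vector_derivative f (at t)) = f'"
    using assms(1) by (intro ext vector_derivative_at)
  then show ?thesis
    using assms differentiableI_vector by auto
qed

lemma n_diff_0I:
  assumes "\<And>x. (f has_vector_derivative f' x) (at x)"
  shows "n_diff 0 f"
  using assms differentiableI_vector by auto

lemma n_diff_const: "n_diff n (\<lambda>x. c)"
proof (induction n arbitrary: c)
  case (Suc n)
  then show ?case by (intro n_diff_SucI[of _ "\<lambda>x. 0"] derivative_intros)
qed simp

lemma n_diff_add: "n_diff n f \<Longrightarrow> n_diff n g \<Longrightarrow> n_diff n (\<lambda>x. f x + g x)"
proof (induction n arbitrary: f g)
  case (Suc n)
  show ?case
    by (rule n_diff_SucI[OF has_vector_derivative_add[OF vector_derivative_works[THEN iffD1]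
          vector_derivative_works[THEN iffD1]]]) (use Suc in auto)
qed auto

lemma n_diff_mult: "n_diff n f \<Longrightarrow> n_diff n g \<Longrightarrow> n_diff n (\<lambda>x. f x * g x)"
proof (induction n arbitrary: f g)
  case (Suc n)
  show ?case
  proof (rule n_diff_SucI[OF has_vector_derivative_mult[OF vector_derivative_works[THEN iffD1]
          vector_derivative_works[THEN iffD1]]])
    show "n_diff n (\<lambda>x. f x * vector_derivative g (at x) + vector_derivative f (at x) * g x)"
      using Suc.prems n_diff_Suc_imp by (intro n_diff_add Suc.IH) auto
  qed (use Suc.prems in auto)
qed auto

lemma smooth_const: "smooth (\<lambda>x. c)"
  by (simp add: smooth_iff_n_diff n_diff_const)

lemma smooth_add: "smooth f \<Longrightarrow> smooth g \<Longrightarrow> smooth (\<lambda>x. f x + g x)"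
  by (simp add: smooth_iff_n_diff n_diff_add)

lemma smooth_mult: "smooth f \<Longrightarrow> smooth g \<Longrightarrow> smooth (\<lambda>x. f x * g x)"
  by (simp add: smooth_iff_n_diff n_diff_mult)

lemma smooth_scale: "smooth f \<Longrightarrow> smooth (\<lambda>x. c * f x)"
  by (rule smooth_mult[OF smooth_const])

lemma smoothI:
  assumes "\<And>x. (f has_vector_derivative \<i> * g x) (at x)" "smooth g"
  shows "smooth f"
  unfolding smooth_iff_n_diff
proof
  show "n_diff n f" for n
  proof (cases n)
    case 0
    then show ?thesis using n_diff_0I[OF assms(1)] by simp
  next
    case (Suc m)
    then show ?thesis
      using n_diff_SucI[OF assms(1)] smooth_scale[OF assms(2)] by (auto simp: smooth_iff_n_diff)
  qed
qed

text \<open>The equation expresses the derivative of \<open>f\<close> through \<open>f\<close> and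
  \<open>g\<close>, so each order of differentiability of \<open>f\<close> yields the next one.
  Solutions of first-order equations thus become smooth without a formula for their higher
  derivatives.\<close>

lemma smooth_bootstrap:
  assumes "\<And>x. (f has_vector_derivative c * f x + g x) (at x)" "smooth g"
  shows "smooth f"
  unfolding smooth_iff_n_diff
proof
  show "n_diff n f" for n
  proof (induction n)
    case 0
    then show ?case using n_diff_0I[OF assms(1)] by simp
  next
    case (Suc n)
    then show ?case
      using assms(2) by (intro n_diff_SucI[OF assms(1)] n_diff_add n_diff_mult n_diff_const)
        (auto simp: smooth_iff_n_diff)
  qed
qed

lemma smooth_of_real: "smooth of_real"
  by (rule smoothI[of _ "\<lambda>x. 1 / \<i>"]) (auto intro!: derivative_eq_intros smooth_const)

lemma smooth_power: "smooth f \<Longrightarrow> smooth (\<lambda>x. f x ^ n)"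
  by (induction n) (auto intro: smooth_const smooth_mult)

lemma has_vector_derivative_exp_scaled:
  "((\<lambda>x::real. exp (a * of_real x) :: complex) has_vector_derivative a * exp (a * of_real x)) (at x)"
proof -
  have "((\<lambda>z. exp (a * z)) has_field_derivative a * exp (a * of_real x)) (at (of_real x))"
    by (auto intro!: derivative_eq_intros)
  from has_vector_derivative_real_field[OF this] show ?thesis by simp
qed

lemma smooth_exp: "smooth (\<lambda>x. exp (a * of_real x))"
  by (rule smooth_bootstrap[of _ a "\<lambda>x. 0"])
    (use has_vector_derivative_exp_scaled smooth_const in auto)

lemma D_op_eqI:
  assumes "\<And>x. (f has_vector_derivative \<i> * g x) (at x)"
  shows "D_op f = g"
  using vector_derivative_at[OF assms] by (simp add: D_op_def fun_eq_iff)

lemma smooth_has_vector_derivative: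
  assumes "smooth f" shows "(f has_vector_derivative \<i> * D_op f x) (at x)"
proof -
  have "f differentiable at x" using assms by (metis smooth_iff_n_diff n_diff.simps(1))
  then show ?thesis by (simp add: D_op_def vector_derivative_works)
qed

lemma smooth_D_op: assumes "smooth f" shows "smooth (D_op f)"
proof -
  have "n_diff n (\<lambda>t. vector_derivative f (at t))" for n
    using assms n_diff.simps(2) by (auto simp: smooth_iff_n_diff simp del: n_diff.simps)
  then have "smooth (\<lambda>x. vector_derivative f (at x))"
    by (simp add: smooth_iff_n_diff)
  from smooth_scale[OF this, of "1 / \<i>"] show ?thesis by (simp add: D_op_def)
qed

lemma smooth_imp_continuous_on: "smooth f \<Longrightarrow> continuous_on S f"
  using smooth_has_vector_derivative has_vector_derivative_continuous
  by (blast intro: continuous_at_imp_continuous_on)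

section \<open>Calculus of the operator D\<close>

lemma D_op_add: "smooth f \<Longrightarrow> smooth g \<Longrightarrow> D_op (\<lambda>x. f x + g x) = (\<lambda>x. D_op f x + D_op g x)"
  by (rule D_op_eqI) (auto intro!: derivative_eq_intros smooth_has_vector_derivative simp: algebra_simps)

lemma D_op_mult:
  "smooth f \<Longrightarrow> smooth g \<Longrightarrow> D_op (\<lambda>x. f x * g x) = (\<lambda>x. D_op f x * g x + f x * D_op g x)"
  by (rule D_op_eqI) (auto intro!: derivative_eq_intros smooth_has_vector_derivative simp: algebra_simps)

lemma D_op_const: "D_op (\<lambda>x. c) = (\<lambda>x. 0)"
  by (rule D_op_eqI) auto

lemma D_op_scale: "smooth f \<Longrightarrow> D_op (\<lambda>x. c * f x) = (\<lambda>x. c * D_op f x)"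
  by (simp add: D_op_mult smooth_const D_op_const)

lemma D_op_exp: "D_op (\<lambda>x. exp (\<i> * a * of_real x)) = (\<lambda>x. a * exp (\<i> * a * of_real x))"
  by (rule D_op_eqI) (use has_vector_derivative_exp_scaled[of "\<i> * a"] in \<open>simp add: algebra_simps\<close>)

lemma D_op_power: "D_op (\<lambda>x. of_real x ^ n) = (\<lambda>x. - \<i> * of_nat n * of_real x ^ (n - 1))"
proof (rule D_op_eqI)
  fix x :: real
  have "((\<lambda>z::complex. z ^ n) has_field_derivative of_nat n * of_real x ^ (n - 1)) (at (of_real x))"
    by (auto intro!: derivative_eq_intros)
  from has_vector_derivative_real_field[OF this]
  show "((\<lambda>x. complex_of_real x ^ n) has_vector_derivative \<i> * (- \<i> * of_nat n * of_real x ^ (n - 1))) (at x)"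
    by (simp add: algebra_simps)
qed

text \<open>Integrating factor: f(x) exp(-i a x) has derivative zero on the whole line.\<close>

lemma smooth_kernel_D_op_minus:
  assumes "smooth f" "(\<lambda>x. D_op f x - a * f x) = (\<lambda>x. 0)"
  shows "f = (\<lambda>x. f 0 * exp (\<i> * a * of_real x))"
proof -
  define g where "g = (\<lambda>x. f x * exp (- (\<i> * a) * of_real x))"
  have Df: "D_op f x = a * f x" for x using fun_cong[OF assms(2), of x] by simp
  have "(g has_vector_derivative 0) (at x)" for x
    unfolding g_def
    by (rule has_vector_derivative_eq_rhs[OF has_vector_derivative_mult[OF
          smooth_has_vector_derivative[OF assms(1)] has_vector_derivative_exp_scaled]])
      (simp add: Df algebra_simps)
  then have "(g has_derivative (\<lambda>h. 0)) (at x within UNIV)" for x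
    by (simp add: has_vector_derivative_def)
  then obtain c where c: "\<And>x. g x = c"
    using has_derivative_zero_constant[of UNIV g] by auto
  have "f x = g x * exp (\<i> * a * of_real x)" for x
    by (simp add: g_def flip: exp_add)
  moreover have "g x = f 0" for x using c[of x] c[of 0] by (simp add: g_def)
  ultimately show ?thesis by (intro ext) metis
qed

section \<open>The action of \<open>\<complex>[D]\<close>\<close>

text \<open>The scalar multiplication of \<open>fun_module\<close>, isolated because it does not
  depend on the carrier.\<close>

definition poly_act :: "complex poly \<Rightarrow> (real \<Rightarrow> complex) \<Rightarrow> real \<Rightarrow> complex" where
  "poly_act p f = (\<lambda>x. \<Sum>j\<le>Polynomial.degree p. Polynomial.coeff p j * (D_op ^^ j) f x)"

lemma poly_act_eq_sum:
  assumes "Polynomial.degree p \<le> n"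
  shows "poly_act p f = (\<lambda>x. \<Sum>j\<le>n. Polynomial.coeff p j * (D_op ^^ j) f x)"
  unfolding poly_act_def
  by (intro ext sum.mono_neutral_left) (use assms in \<open>auto simp: coeff_eq_0\<close>)

lemma poly_act_0 [simp]: "poly_act 0 f = (\<lambda>x. 0)"
  by (simp add: poly_act_def)

text \<open>The recursion behind the inductions over polynomials. The sum is padded up to
  \<open>Suc (degree p)\<close>, which exceeds the true degree when \<open>p = 0\<close>.\<close>

lemma poly_act_pCons: "poly_act (pCons c p) f = (\<lambda>x. c * f x + poly_act p (D_op f) x)"
proof -
  have "poly_act (pCons c p) f =
      (\<lambda>x. \<Sum>j\<le>Suc (Polynomial.degree p). Polynomial.coeff (pCons c p) j * (D_op ^^ j) f x)"
    by (rule poly_act_eq_sum) (rule degree_pCons_le)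
  then show ?thesis
    by (simp add: sum.atMost_Suc_shift poly_act_def funpow_Suc_right del: sum.atMost_Suc funpow.simps(2))
qed

lemma poly_act_1: "poly_act 1 f = f"
  by (simp add: one_pCons poly_act_pCons)

lemma poly_act_const: "poly_act [:c:] f = (\<lambda>x. c * f x)"
  by (simp add: poly_act_pCons)

lemma poly_act_linear_factor: "poly_act [:- a, 1:] f = (\<lambda>x. D_op f x - a * f x)"
  by (simp add: poly_act_pCons)

lemma poly_act_add_left: "poly_act (p + q) f = (\<lambda>x. poly_act p f x + poly_act q f x)"
  using poly_act_eq_sum[of p "max (Polynomial.degree p) (Polynomial.degree q)" f]
    poly_act_eq_sum[of q "max (Polynomial.degree p) (Polynomial.degree q)" f]
    poly_act_eq_sum[of "p + q" "max (Polynomial.degree p) (Polynomial.degree q)" f]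
    degree_add_le_max[of p q]
  by (simp add: sum.distrib algebra_simps)

lemma poly_act_smult_left: "poly_act (Polynomial.smult c p) f = (\<lambda>x. c * poly_act p f x)"
  using poly_act_eq_sum[of "Polynomial.smult c p" "Polynomial.degree p" f] degree_smult_le[of c p]
  by (simp add: poly_act_def sum_distrib_left mult.assoc)

text \<open>The submodules of the space of all smooth functions, stated through closure under
  constants and D because these generate C[D]; see \<open>submodule_fun_module_iff\<close>.\<close>

definition D_stable :: "(real \<Rightarrow> complex) set \<Rightarrow> bool" where
  "D_stable B \<longleftrightarrow> B \<subseteq> Collect smooth \<and> (\<lambda>x. 0) \<in> B \<and>
     (\<forall>f\<in>B. \<forall>g\<in>B. (\<lambda>x. f x + g x) \<in> B) \<and> (\<forall>c. \<forall>f\<in>B. (\<lambda>x. c * f x) \<in> B) \<and> (\<forall>f\<in>B. D_op f \<in> B)"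

lemma D_stableD:
  assumes "D_stable B"
  shows "f \<in> B \<Longrightarrow> smooth f" "(\<lambda>x. 0) \<in> B"
    "f \<in> B \<Longrightarrow> g \<in> B \<Longrightarrow> (\<lambda>x. f x + g x) \<in> B" "f \<in> B \<Longrightarrow> (\<lambda>x. c * f x) \<in> B"
    "f \<in> B \<Longrightarrow> D_op f \<in> B"
  using assms unfolding D_stable_def by auto

lemma D_stable_diff: assumes "D_stable B" "f \<in> B" "g \<in> B" shows "(\<lambda>x. f x - g x) \<in> B"
  using D_stableD(3)[OF assms(1,2) D_stableD(4)[OF assms(1,3), of "-1"]] by simp

lemma D_stable_sum:
  assumes "D_stable B" "\<And>i. i \<in> I \<Longrightarrow> f i \<in> B"
  shows "(\<lambda>x. \<Sum>i\<in>I. f i x) \<in> B"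
  using assms(2)
  by (induction I rule: infinite_finite_induct) (auto intro: D_stableD(2,3)[OF assms(1)])

lemma D_stable_smooth: "D_stable (Collect smooth)"
  by (auto simp: D_stable_def intro: smooth_const smooth_add smooth_scale smooth_D_op)

lemma poly_act_closed: assumes "D_stable B" "f \<in> B" shows "poly_act p f \<in> B"
  using assms(2)
proof (induction p arbitrary: f)
  case 0
  then show ?case by (simp add: D_stableD(2)[OF assms(1)])
next
  case (pCons c p)
  note B = D_stableD[OF assms(1)]
  show ?case
    using B(3)[OF B(4)[OF pCons.prems] pCons.IH[OF B(5)[OF pCons.prems]]] by (simp add: poly_act_pCons)
qed

lemma smooth_poly_act: "smooth f \<Longrightarrow> smooth (poly_act p f)"
  using poly_act_closed[OF D_stable_smooth] by simp

lemma poly_act_add_right: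
  "smooth f \<Longrightarrow> smooth g \<Longrightarrow> poly_act p (\<lambda>x. f x + g x) = (\<lambda>x. poly_act p f x + poly_act p g x)"
  by (induction p arbitrary: f g) (simp_all add: poly_act_pCons D_op_add smooth_D_op algebra_simps)

lemma poly_act_scale_right:
  "smooth f \<Longrightarrow> poly_act p (\<lambda>x. c * f x) = (\<lambda>x. c * poly_act p f x)"
  by (induction p arbitrary: f) (simp_all add: poly_act_pCons D_op_scale smooth_D_op algebra_simps)

lemma poly_act_diff_right:
  assumes "smooth f" "smooth g"
  shows "poly_act p (\<lambda>x. f x - g x) = (\<lambda>x. poly_act p f x - poly_act p g x)"
  using poly_act_add_right[OF assms(1) smooth_scale[OF assms(2)], of p "-1"]
    poly_act_scale_right[OF assms(2), of p "-1"] by simp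

lemma poly_act_zero_right: "poly_act p (\<lambda>x. 0) = (\<lambda>x. 0)"
  using poly_act_scale_right[OF smooth_const, of p 0 0] by simp

lemma poly_act_D_op: "smooth f \<Longrightarrow> poly_act p (D_op f) = D_op (poly_act p f)"
  by (induction p arbitrary: f)
    (simp_all add: poly_act_pCons D_op_const D_op_add D_op_scale smooth_D_op smooth_scale smooth_poly_act)

lemma poly_act_mult: "smooth f \<Longrightarrow> poly_act (p * q) f = poly_act p (poly_act q f)"
proof (induction p arbitrary: f)
  case (pCons c p)
  then show ?case
    by (simp add: mult_pCons_left poly_act_add_left poly_act_smult_left poly_act_pCons
        smooth_D_op smooth_poly_act poly_act_D_op)
qed simp

lemma poly_act_factor:
  assumes "smooth f"
  shows "poly_act ([:- a, 1:] * p) f = (\<lambda>x. D_op (poly_act p f) x - a * poly_act p f x)"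
  unfolding poly_act_mult[OF assms] poly_act_linear_factor ..

text \<open>Every nonconstant complex polynomial has a root, so questions about p(D) reduce to its
  linear factors D - a.\<close>

lemma complex_poly_factor_induct [consumes 1, case_names const factor]:
  fixes p :: "complex poly"
  assumes "p \<noteq> 0" "\<And>c. c \<noteq> 0 \<Longrightarrow> P [:c:]"
    "\<And>a p. p \<noteq> 0 \<Longrightarrow> P p \<Longrightarrow> P ([:- a, 1:] * p)"
  shows "P p"
  using assms(1)
proof (induction "Polynomial.degree p" arbitrary: p)
  case 0
  then obtain c where "p = [:c:]" using degree_eq_zeroE by metis
  then show ?case using 0 assms(2) by auto
next
  case (Suc n)
  then have "\<not> constant (poly p)" using constant_degree[of p] by simp
  then obtain a where "poly p a = 0" using fundamental_theorem_of_algebra by blast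
  then obtain q where q: "p = [:- a, 1:] * q" by (auto simp: poly_eq_0_iff_dvd elim: dvdE)
  then have "q \<noteq> 0" using Suc.prems by auto
  then have "Polynomial.degree p = Suc (Polynomial.degree q)" using q by (subst q, subst degree_mult_eq) auto
  then show ?case using Suc q \<open>q \<noteq> 0\<close> assms(3) by simp
qed

section \<open>The principal ideal domain C[D] and its modules of functions\<close>

lemma principal_domain_CD: "principal_domain CD"
proof -
  interpret cring CD by (rule cring_from_type_algebra)
  interpret domain CD
    by (rule domain.intro[OF is_cring domain_axioms.intro]) (auto simp: ring_of_type_algebra_def)
  interpret euclidean_domain CD Polynomial.degree
  proof (rule euclidean_domain.intro[OF domain_axioms euclidean_domain_axioms.intro])
    fix a b assume "b \<in> carrier CD - {\<zero>\<^bsub>CD\<^esub>}"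
    then show "\<exists>q r. q \<in> carrier CD \<and> r \<in> carrier CD \<and> a = b \<otimes>\<^bsub>CD\<^esub> q \<oplus>\<^bsub>CD\<^esub> r \<and>
        (r = \<zero>\<^bsub>CD\<^esub> \<or> Polynomial.degree r < Polynomial.degree b)"
      using degree_mod_less[of b a]
      by (intro exI[of _ "a div b"] exI[of _ "a mod b"]) (auto simp: ring_of_type_algebra_def)
  qed
  show ?thesis by (rule principal_domain_axioms)
qed

lemma CD_simps:
  "carrier CD = UNIV" "\<zero>\<^bsub>CD\<^esub> = 0" "\<one>\<^bsub>CD\<^esub> = 1" "p \<oplus>\<^bsub>CD\<^esub> q = p + q" "p \<otimes>\<^bsub>CD\<^esub> q = p * q"
  by (simp_all add: ring_of_type_algebra_def)

lemma fun_module_simps: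
  "carrier (fun_module B) = B" "\<zero>\<^bsub>fun_module B\<^esub> = (\<lambda>x. 0)"
  "f \<oplus>\<^bsub>fun_module B\<^esub> g = (\<lambda>x. f x + g x)" "p \<odot>\<^bsub>fun_module B\<^esub> f = poly_act p f"
  "(fun_module B)\<lparr>carrier := C\<rparr> = fun_module C"
  by (simp_all add: fun_module_def poly_act_def)

lemma module_fun_module: assumes "D_stable B" shows "Module.module CD (fun_module B)"
proof (rule moduleI)
  note B = D_stableD[OF assms]
  show "cring CD" by (rule cring_from_type_algebra)
  show "abelian_group (fun_module B)"
  proof (rule abelian_groupI)
    show "\<exists>g\<in>carrier (fun_module B). g \<oplus>\<^bsub>fun_module B\<^esub> f = \<zero>\<^bsub>fun_module B\<^esub>"
      if "f \<in> carrier (fun_module B)" for f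
      using that B(4)[of f "-1"] by (auto simp: fun_module_simps intro!: bexI[of _ "\<lambda>x. - f x"])
  qed (auto simp: fun_module_simps B algebra_simps)
qed (auto simp: fun_module_simps CD_simps poly_act_closed[OF assms] poly_act_add_left
    poly_act_add_right poly_act_mult poly_act_1 D_stableD(1)[OF assms])

lemma submodule_fun_module_iff:
  assumes "D_stable B"
  shows "submodule K CD (fun_module B) \<longleftrightarrow> K \<subseteq> B \<and> D_stable K"
proof
  interpret Module.module CD "fun_module B" by (rule module_fun_module[OF assms])
  note B = D_stableD[OF assms]
  assume K: "submodule K CD (fun_module B)"
  note KE = submoduleE[OF K, unfolded CD_simps fun_module_simps]
  have act: "poly_act p f \<in> K" if "f \<in> K" for p f using KE(4)[OF _ that] by simp
  obtain f where "f \<in> K" using KE(2) by auto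
  then have "(\<lambda>x. 0) \<in> K" using act[of f 0] by simp
  moreover have "(\<lambda>x. c * f x) \<in> K" if "f \<in> K" for c f
    using act[OF that, of "[:c:]"] by (simp add: poly_act_const)
  moreover have "D_op f \<in> K" if "f \<in> K" for f
    \<comment> \<open>The polynomial X, written as a linear factor with root 0 so that
      \<open>poly_act_linear_factor\<close> matches.\<close>
    using act[OF that, of "[:-0, 1:]"] unfolding poly_act_linear_factor by simp
  ultimately show "K \<subseteq> B \<and> D_stable K"
    using KE(1,5) B(1) by (auto simp: D_stable_def)
next
  interpret Module.module CD "fun_module B" by (rule module_fun_module[OF assms])
  assume K: "K \<subseteq> B \<and> D_stable K"
  then have "Module.module CD ((fun_module B)\<lparr>carrier := K\<rparr>)"
    by (simp add: fun_module_simps module_fun_module)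
  then show "submodule K CD (fun_module B)"
    using K by (intro module_incl_imp_submodule) (auto simp: fun_module_simps)
qed

section \<open>Injective envelopes of \<open>D\<close>-stable function spaces\<close>

definition D_divisible :: "(real \<Rightarrow> complex) set \<Rightarrow> bool" where
  "D_divisible B \<longleftrightarrow> (\<forall>a. \<forall>g\<in>B. \<exists>h\<in>B. (\<lambda>x. D_op h x - a * h x) = g)"

text \<open>For p = (X - a) q, solve (D - a) h = g first and then q(D) k = h; by induction,
  divisibility by linear factors is enough.\<close>

lemma divisible_fun_module_iff:
  assumes "D_stable B"
  shows "divisible_module CD (fun_module B) \<longleftrightarrow> D_divisible B"
proof
  assume div: "divisible_module CD (fun_module B)"
  have "\<exists>h\<in>B. poly_act [:- a, 1:] h = g" if "g \<in> B" for a g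
    using div[unfolded divisible_module_def CD_simps fun_module_simps, rule_format, of "[:- a, 1:]" g] that
    by simp
  then show "D_divisible B" unfolding D_divisible_def poly_act_linear_factor by blast
next
  assume div: "D_divisible B"
  have "\<exists>h\<in>B. poly_act p h = g" if "p \<noteq> 0" "g \<in> B" for p g
    using that
  proof (induction p arbitrary: g rule: complex_poly_factor_induct)
    case (const c)
    then show ?case
      using D_stableD(4)[OF assms const(2), of "1 / c"]
      by (intro bexI[of _ "\<lambda>x. 1 / c * g x"]) (auto simp: poly_act_const)
  next
    case (factor a p)
    obtain h where h: "h \<in> B" "(\<lambda>x. D_op h x - a * h x) = g"
      using div factor.prems unfolding D_divisible_def by blast
    obtain k where k: "k \<in> B" "poly_act p k = h"
      using factor.IH[OF h(1)] by blast
    show ?case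
      using h(2) k(2) by (intro bexI[OF _ k(1)]) (simp only: poly_act_factor[OF D_stableD(1)[OF assms k(1)]])
  qed
  then show "divisible_module CD (fun_module B)"
    unfolding divisible_module_def CD_simps fun_module_simps by blast
qed

lemma injective_fun_module_iff:
  assumes "D_stable B"
  shows "injective_module U CD (fun_module B) \<longleftrightarrow> D_divisible B"
  using divisible_imp_injective_module[OF principal_domain_CD module_fun_module[OF assms]]
    injective_imp_divisible_module[OF principal_domain.axioms(1)[OF principal_domain_CD]]
    divisible_fun_module_iff[OF assms] by blast

text \<open>For a submodule \<open>N\<close> of \<open>E\<close>, the preimage in \<open>E\<close>
  of the torsion submodule of \<open>E / N\<close>.\<close>

definition torsion_closure :: "(real \<Rightarrow> complex) set \<Rightarrow> (real \<Rightarrow> complex) set \<Rightarrow> (real \<Rightarrow> complex) set" where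
  "torsion_closure N E = {g \<in> E. \<exists>p. p \<noteq> 0 \<and> poly_act p g \<in> N}"

text \<open>The decisive assumption is \<open>kernel\<close>: all eigenfunctions of D in
  \<open>E\<close> already lie in \<open>N\<close>. It gives both torsion-freeness of quotients,
  hence uniqueness of the envelope, and essentiality.\<close>

locale D_divisible_extension =
  fixes N E :: "(real \<Rightarrow> complex) set"
  assumes stable_N: "D_stable N" and stable_E: "D_stable E" and subset: "N \<subseteq> E"
    and div_E: "D_divisible E"
    and kernel: "\<And>a g. g \<in> E \<Longrightarrow> (\<lambda>x. D_op g x - a * g x) = (\<lambda>x. 0) \<Longrightarrow> g \<in> N"
begin

text \<open>If (D - a) u lies in \<open>H\<close>, divisibility gives h in \<open>H\<close> with (D
  - a) h = (D - a) u. Then u - h is in the kernel, hence in \<open>N\<close> and so in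
  \<open>H\<close>. Iterate over the linear factors of \<open>p\<close>.\<close>

lemma torsion_free_quotient:
  assumes H: "D_stable H" "N \<subseteq> H" "H \<subseteq> E" "D_divisible H"
    and "p \<noteq> 0" "g \<in> E" "poly_act p g \<in> H"
  shows "g \<in> H"
  using assms(5-7)
proof (induction p arbitrary: g rule: complex_poly_factor_induct)
  case (const c)
  then show ?case
    using D_stableD(4)[OF H(1) const(3), of "1 / c"] by (simp add: poly_act_const)
next
  case (factor a p)
  note smooth = D_stableD(1)[OF stable_E]
  define u where "u = poly_act p g"
  have u: "u \<in> E" using factor.prems by (simp add: u_def poly_act_closed[OF stable_E])
  have "(\<lambda>x. D_op u x - a * u x) \<in> H"
    using factor.prems(2) unfolding poly_act_factor[OF smooth[OF factor.prems(1)]] u_def .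
  then obtain h where h: "h \<in> H" "(\<lambda>x. D_op h x - a * h x) = (\<lambda>x. D_op u x - a * u x)"
    using H(4) unfolding D_divisible_def by metis
  have diff: "(\<lambda>x. u x - h x) \<in> E" using u h(1) H(3) D_stable_diff[OF stable_E] by auto
  have "poly_act [:- a, 1:] (\<lambda>x. u x - h x) = (\<lambda>x. 0)"
    using u h H(3) smooth by (subst poly_act_diff_right) (auto simp: poly_act_linear_factor fun_eq_iff)
  then have "(\<lambda>x. u x - h x) \<in> H"
    using kernel[OF diff, of a] H(2) by (auto simp: poly_act_linear_factor)
  from D_stableD(3)[OF H(1) this h(1)] have "u \<in> H" by simp
  then show ?case using factor.IH factor.prems by (simp add: u_def)
qed

lemma subset_torsion_closure: "N \<subseteq> torsion_closure N E"
  unfolding torsion_closure_def using subset by (auto intro!: exI[of _ 1] simp: poly_act_1)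

lemma torsion_closure_subset: "torsion_closure N E \<subseteq> E"
  by (auto simp: torsion_closure_def)

lemma D_stable_torsion_closure: "D_stable (torsion_closure N E)"
  unfolding D_stable_def
proof (intro conjI ballI allI)
  note E = D_stableD[OF stable_E]
  show "torsion_closure N E \<subseteq> Collect smooth" using torsion_closure_subset E(1) by auto
  show "(\<lambda>x. 0) \<in> torsion_closure N E" using subset_torsion_closure D_stableD(2)[OF stable_N] by auto
  fix f assume "f \<in> torsion_closure N E"
  then obtain p where f: "f \<in> E" "p \<noteq> 0" "poly_act p f \<in> N" by (auto simp: torsion_closure_def)
  show "(\<lambda>x. c * f x) \<in> torsion_closure N E" for c
    unfolding torsion_closure_def using f E(1,4) D_stableD(4)[OF stable_N]
    by (auto intro!: exI[of _ p] simp: poly_act_scale_right)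
  show "D_op f \<in> torsion_closure N E"
    unfolding torsion_closure_def using f E(1,5) D_stableD(5)[OF stable_N]
    by (auto intro!: exI[of _ p] simp: poly_act_D_op)
  fix g assume "g \<in> torsion_closure N E"
  then obtain q where g: "g \<in> E" "q \<noteq> 0" "poly_act q g \<in> N" by (auto simp: torsion_closure_def)
  \<comment> \<open>As C[D] is commutative, the product of the two multipliers moves both functions
    into \<open>N\<close>.\<close>
  have "poly_act (q * p) f \<in> N" "poly_act (p * q) g \<in> N"
    using f g E(1) by (simp_all add: poly_act_mult poly_act_closed[OF stable_N])
  then have "poly_act (p * q) (\<lambda>x. f x + g x) \<in> N"
    using f g E(1) D_stableD(3)[OF stable_N] by (simp add: poly_act_add_right mult.commute)
  then show "(\<lambda>x. f x + g x) \<in> torsion_closure N E"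
    unfolding torsion_closure_def using f g E(3) by (auto intro!: exI[of _ "p * q"])
qed

lemma D_divisible_torsion_closure: "D_divisible (torsion_closure N E)"
  unfolding D_divisible_def
proof (intro allI ballI)
  fix a g assume "g \<in> torsion_closure N E"
  then obtain p where g: "g \<in> E" "p \<noteq> 0" "poly_act p g \<in> N" by (auto simp: torsion_closure_def)
  obtain h where h: "h \<in> E" "(\<lambda>x. D_op h x - a * h x) = g"
    using div_E g(1) unfolding D_divisible_def by blast
  \<comment> \<open>If \<open>p\<close> moves \<open>g\<close> into \<open>N\<close>, then p (X - a)
    moves every solution of (D - a) h = g there.\<close>
  have "poly_act (p * [:- a, 1:]) h \<in> N"
    using h g D_stableD(1)[OF stable_E] by (subst poly_act_mult) (auto simp: poly_act_linear_factor)
  moreover have "p * [:- a, 1:] \<noteq> 0" using g(2) by (simp del: mult_pCons_right)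
  ultimately have "h \<in> torsion_closure N E"
    unfolding torsion_closure_def using h(1) by blast
  then show "\<exists>h\<in>torsion_closure N E. (\<lambda>x. D_op h x - a * h x) = g" using h(2) by blast
qed

text \<open>Essentiality. Apply the linear factors of \<open>p\<close> to \<open>g\<close> one at a
  time. If the result ever becomes zero, the last nonzero function is an eigenfunction and lies in
  \<open>N\<close> by \<open>kernel\<close>; otherwise p(D) g itself is a nonzero element of
  \<open>N\<close>. All these functions stay in \<open>K\<close>.\<close>

lemma nonzero_mem_Int:
  assumes K: "D_stable K" "K \<subseteq> E"
    and "p \<noteq> 0" "g \<in> K" "g \<noteq> (\<lambda>x. 0)" "poly_act p g \<in> N"
  shows "\<exists>u\<in>K \<inter> N. u \<noteq> (\<lambda>x. 0)"
  using assms(3-6)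
proof (induction p rule: complex_poly_factor_induct)
  case (const c)
  then have "g \<in> N"
    using D_stableD(4)[OF stable_N const(4), of "1 / c"] by (simp add: poly_act_const)
  then show ?case using const by blast
next
  case (factor a p)
  define u where "u = poly_act p g"
  have u: "u \<in> K" using factor.prems by (simp add: u_def poly_act_closed[OF K(1)])
  have Du: "(\<lambda>x. D_op u x - a * u x) \<in> N"
    using factor.prems(3) unfolding poly_act_factor[OF D_stableD(1)[OF K(1) factor.prems(1)]] u_def .
  have DuK: "(\<lambda>x. D_op u x - a * u x) \<in> K"
    using poly_act_closed[OF K(1) u, of "[:- a, 1:]"] by (simp add: poly_act_linear_factor)
  consider "u = (\<lambda>x. 0)" | "u \<noteq> (\<lambda>x. 0)" "(\<lambda>x. D_op u x - a * u x) = (\<lambda>x. 0)"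
    | "(\<lambda>x. D_op u x - a * u x) \<noteq> (\<lambda>x. 0)" by blast
  then show ?case
  proof cases
    case 1
    then show ?thesis
      using factor.IH factor.prems D_stableD(2)[OF stable_N] by (simp add: u_def)
  next
    case 2
    then show ?thesis using kernel[of u a] u K(2) by blast
  next
    case 3
    then show ?thesis using Du DuK by blast
  qed
qed

text \<open>Divisibility of \<open>H\<close> bounds it from below, because \<open>E / H\<close> is
  then torsion-free. Essentiality bounds it from above, because every nonzero cyclic submodule of
  \<open>H\<close> meets \<open>N\<close> nontrivially.\<close>

lemma injective_envelope_iff:
  "injective_envelope_in U CD N (fun_module E) H \<longleftrightarrow> H = torsion_closure N E"
proof
  assume "injective_envelope_in U CD N (fun_module E) H"
  then have H: "D_stable H" "H \<subseteq> E" "N \<subseteq> H" "D_divisible H"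
    and ess: "\<And>K. D_stable K \<Longrightarrow> K \<subseteq> H \<Longrightarrow> K \<noteq> {\<lambda>x. 0} \<Longrightarrow> K \<inter> N \<noteq> {\<lambda>x. 0}"
    by (auto simp: injective_envelope_in_def essential_extension_def submodule_fun_module_iff stable_E
        injective_fun_module_iff fun_module_simps)
  show "H = torsion_closure N E"
  proof
    show "torsion_closure N E \<subseteq> H"
      unfolding torsion_closure_def using torsion_free_quotient[OF H(1,3,2,4)] H(3) by auto
    show "H \<subseteq> torsion_closure N E"
    proof
      fix g assume g: "g \<in> H"
      \<comment> \<open>The cyclic submodule generated by \<open>g\<close>: a nonzero element of its
        intersection with \<open>N\<close> is p(D) g for some nonzero p.\<close>
      define K where "K = range (\<lambda>p. poly_act p g)"
      have smooth: "smooth g" using D_stableD(1)[OF H(1) g] .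
      have "D_stable K"
        unfolding D_stable_def
      proof (intro conjI ballI allI)
        show "K \<subseteq> Collect smooth" using smooth by (auto simp: K_def smooth_poly_act)
        show "(\<lambda>x. 0) \<in> K" by (auto simp: K_def intro!: image_eqI[of _ _ 0])
        fix f assume "f \<in> K"
        then obtain p where p: "f = poly_act p g" by (auto simp: K_def)
        show "(\<lambda>x. c * f x) \<in> K" for c
          unfolding K_def p poly_act_smult_left[symmetric] by blast
        show "D_op f \<in> K"
          using smooth by (auto simp: K_def p poly_act_pCons poly_act_D_op intro!: image_eqI[of _ _ "pCons 0 p"])
        fix f' assume "f' \<in> K"
        then obtain q where q: "f' = poly_act q g" by (auto simp: K_def)
        show "(\<lambda>x. f x + f' x) \<in> K"
          unfolding K_def p q poly_act_add_left[symmetric] by blast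
      qed
      moreover have "K \<subseteq> H" using g by (auto simp: K_def poly_act_closed[OF H(1)])
      \<comment> \<open>\<open>ess\<close> only says that the intersection differs from the zero
        set. Knowing that it contains 0, one gets a nonzero element.\<close>
      moreover have "(\<lambda>x. 0) \<in> K \<inter> N"
        using calculation D_stableD(2)[OF stable_N] D_stableD(2) by blast
      moreover have "g \<in> K" using poly_act_1[of g] unfolding K_def by (metis rangeI)
      ultimately consider "g = (\<lambda>x. 0)" | u where "u \<in> K \<inter> N" "u \<noteq> (\<lambda>x. 0)"
        using ess[of K] by blast
      then show "g \<in> torsion_closure N E"
      proof cases
        case 1
        then show ?thesis using D_stableD(2)[OF D_stable_torsion_closure] by simp
      next
        case 2
        then obtain p where "u = poly_act p g" by (auto simp: K_def)
        with 2 have "p \<noteq> 0" "poly_act p g \<in> N" by auto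
        then show ?thesis using g H(2) by (auto simp: torsion_closure_def)
      qed
    qed
  qed
next
  assume H: "H = torsion_closure N E"
  have "K \<inter> N \<noteq> {\<lambda>x. 0}" if K: "D_stable K" "K \<subseteq> H" "K \<noteq> {\<lambda>x. 0}" for K
  proof -
    obtain g where g: "g \<in> K" "g \<noteq> (\<lambda>x. 0)" using K D_stableD(2)[of K] by blast
    then obtain p where "p \<noteq> 0" "poly_act p g \<in> N" "K \<subseteq> E"
      using K(2) torsion_closure_subset unfolding H torsion_closure_def by blast
    then show ?thesis using nonzero_mem_Int[OF K(1) _ _ g] by blast
  qed
  then show "injective_envelope_in U CD N (fun_module E) H"
    using stable_N stable_E subset_torsion_closure torsion_closure_subset D_stable_torsion_closure
      D_divisible_torsion_closure
    by (simp add: injective_envelope_in_def essential_extension_def submodule_fun_module_iff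
        injective_fun_module_iff fun_module_simps H)
qed

end

section \<open>Polynomials in \<open>x\<close> over a \<open>D\<close>-stable function space\<close>

text \<open>Degree strictly below n, so that inductions start at the zero space. The coefficients
  are existential: that they are determined by the function needs the periodicity used in
  \<open>poly_lt_top_coeff_zero\<close>.\<close>

primrec poly_lt :: "(real \<Rightarrow> complex) set \<Rightarrow> nat \<Rightarrow> (real \<Rightarrow> complex) set" where
  "poly_lt B 0 = {\<lambda>x. 0}"
| "poly_lt B (Suc n) = {(\<lambda>x. h x + f x * of_real x ^ n) | h f. h \<in> poly_lt B n \<and> f \<in> B}"

lemma poly_lt_SucI: "h \<in> poly_lt B n \<Longrightarrow> f \<in> B \<Longrightarrow> (\<lambda>x. h x + f x * of_real x ^ n) \<in> poly_lt B (Suc n)"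
  by auto

lemma poly_lt_SucE:
  assumes "g \<in> poly_lt B (Suc n)"
  obtains h f where "h \<in> poly_lt B n" "f \<in> B" "g = (\<lambda>x. h x + f x * of_real x ^ n)"
  using assms by auto

declare poly_lt.simps(2) [simp del]

lemma poly_lt_iff_sum:
  "g \<in> poly_lt B n \<longleftrightarrow> (\<exists>f. (\<forall>j<n. f j \<in> B) \<and> g = (\<lambda>x. \<Sum>j<n. f j x * of_real x ^ j))"
proof (induction n arbitrary: g)
  case (Suc n)
  show ?case
  proof
    assume "g \<in> poly_lt B (Suc n)"
    then obtain h f where h: "h \<in> poly_lt B n" "f \<in> B" "g = (\<lambda>x. h x + f x * of_real x ^ n)"
      by (rule poly_lt_SucE)
    then obtain F where F: "\<forall>j<n. F j \<in> B" "h = (\<lambda>x. \<Sum>j<n. F j x * of_real x ^ j)"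
      using Suc.IH by blast
    show "\<exists>f. (\<forall>j<Suc n. f j \<in> B) \<and> g = (\<lambda>x. \<Sum>j<Suc n. f j x * of_real x ^ j)"
      by (rule exI[of _ "F(n := f)"]) (use F h in \<open>auto simp: less_Suc_eq\<close>)
  next
    assume "\<exists>f. (\<forall>j<Suc n. f j \<in> B) \<and> g = (\<lambda>x. \<Sum>j<Suc n. f j x * of_real x ^ j)"
    then obtain f where f: "\<forall>j<Suc n. f j \<in> B" "g = (\<lambda>x. \<Sum>j<Suc n. f j x * of_real x ^ j)" by blast
    have "(\<lambda>x. \<Sum>j<n. f j x * of_real x ^ j) \<in> poly_lt B n"
      unfolding Suc.IH using f(1) by (intro exI[of _ f]) auto
    from poly_lt_SucI[OF this, of "f n"] show "g \<in> poly_lt B (Suc n)" using f by simp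
  qed
qed auto

lemma adjoin_x_eq_poly_lt: "adjoin_x B = (\<Union>n. poly_lt B (Suc n))"
  unfolding set_eq_iff UN_iff poly_lt_iff_sum adjoin_x_def lessThan_Suc_atMost less_Suc_eq_le by simp

locale D_stable_space =
  fixes B :: "(real \<Rightarrow> complex) set"
  assumes stable: "D_stable B"
begin

lemmas stableD = D_stableD[OF stable]

lemma poly_lt_Suc_mono: "poly_lt B n \<subseteq> poly_lt B (Suc n)"
proof
  fix h assume "h \<in> poly_lt B n"
  from poly_lt_SucI[OF this stableD(2)] show "h \<in> poly_lt B (Suc n)" by simp
qed

lemma poly_lt_mono: "n \<le> m \<Longrightarrow> poly_lt B n \<subseteq> poly_lt B m"
  by (induction m rule: dec_induct) (use poly_lt_Suc_mono in blast)+

lemma zero_poly_lt: "(\<lambda>x. 0) \<in> poly_lt B n"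
  using poly_lt_mono[of 0 n] by auto

lemma monomial_poly_lt: "f \<in> B \<Longrightarrow> (\<lambda>x. f x * of_real x ^ j) \<in> poly_lt B (Suc j)"
  using poly_lt_SucI[OF zero_poly_lt] by simp

text \<open>The lower-order term of D(f x^n). The truncated exponent at n = 0 is harmless, since the
  factor \<open>of_nat n\<close> vanishes.\<close>

lemma derivative_monomial_poly_lt:
  assumes "f \<in> B" shows "(\<lambda>x. - \<i> * of_nat n * f x * of_real x ^ (n - 1)) \<in> poly_lt B n"
proof (cases n)
  case (Suc m)
  then show ?thesis
    using monomial_poly_lt[OF stableD(4)[OF assms, of "- \<i> * of_nat n"], of m] by simp
qed simp

end

lemma D_op_mult_power:
  assumes "smooth f"
  shows "D_op (\<lambda>x. f x * of_real x ^ n) =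
    (\<lambda>x. D_op f x * of_real x ^ n - \<i> * of_nat n * f x * of_real x ^ (n - 1))"
  using D_op_mult[OF assms smooth_power[OF smooth_of_real, of n]] by (simp add: D_op_power algebra_simps)

lemma (in D_stable_space) D_stable_poly_lt: "D_stable (poly_lt B n)"
proof (induction n)
  case 0
  show ?case by (simp add: D_stable_def smooth_const D_op_const)
next
  case (Suc n)
  note H = D_stableD[OF Suc.IH]
  show ?case
    unfolding D_stable_def
  proof (intro conjI ballI allI)
    show "poly_lt B (Suc n) \<subseteq> Collect smooth"
      using H(1) stableD(1) by (auto elim!: poly_lt_SucE intro!: smooth_add smooth_mult smooth_power smooth_of_real)
    show "(\<lambda>x. 0) \<in> poly_lt B (Suc n)" by (rule zero_poly_lt)
    fix g assume "g \<in> poly_lt B (Suc n)"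
    then obtain h f where g: "h \<in> poly_lt B n" "f \<in> B" "g = (\<lambda>x. h x + f x * of_real x ^ n)"
      by (rule poly_lt_SucE)
    show "(\<lambda>x. c * g x) \<in> poly_lt B (Suc n)" for c
      using poly_lt_SucI[OF H(4)[OF g(1), of c] stableD(4)[OF g(2), of c]]
      by (simp add: g(3) algebra_simps)
    show "D_op g \<in> poly_lt B (Suc n)"
    proof -
      have "D_op g = (\<lambda>x. D_op h x + D_op (\<lambda>x. f x * of_real x ^ n) x)"
        unfolding g(3) using H(1)[OF g(1)] stableD(1)[OF g(2)]
        by (intro D_op_add smooth_mult smooth_power smooth_of_real)
      then show ?thesis
        using poly_lt_SucI[OF H(3)[OF H(5)[OF g(1)] derivative_monomial_poly_lt[OF g(2)]] stableD(5)[OF g(2)]]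
        by (simp add: D_op_mult_power stableD(1)[OF g(2)] algebra_simps)
    qed
    fix g' assume "g' \<in> poly_lt B (Suc n)"
    then obtain h' f' where g': "h' \<in> poly_lt B n" "f' \<in> B" "g' = (\<lambda>x. h' x + f' x * of_real x ^ n)"
      by (rule poly_lt_SucE)
    show "(\<lambda>x. g x + g' x) \<in> poly_lt B (Suc n)"
      using poly_lt_SucI[OF H(3)[OF g(1) g'(1)] stableD(3)[OF g(2) g'(2)]]
      by (simp add: g(3) g'(3) algebra_simps)
  qed
qed

context D_stable_space begin

lemma D_stable_adjoin_x: "D_stable (adjoin_x B)"
proof -
  note P = D_stableD[OF D_stable_poly_lt]
  have dir: "\<exists>n. f \<in> poly_lt B (Suc n) \<and> g \<in> poly_lt B (Suc n)"
    if fg: "f \<in> adjoin_x B" "g \<in> adjoin_x B" for f g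
  proof -
    obtain n m where "f \<in> poly_lt B (Suc n)" "g \<in> poly_lt B (Suc m)"
      using fg unfolding adjoin_x_eq_poly_lt by blast
    then have "f \<in> poly_lt B (Suc (max n m))" "g \<in> poly_lt B (Suc (max n m))"
      using poly_lt_mono[of "Suc n" "Suc (max n m)"] poly_lt_mono[of "Suc m" "Suc (max n m)"] by auto
    then show ?thesis by blast
  qed
  show ?thesis
    unfolding D_stable_def
  proof (intro conjI ballI allI)
    show "adjoin_x B \<subseteq> Collect smooth" unfolding adjoin_x_eq_poly_lt using P(1) by blast
    show "(\<lambda>x. 0) \<in> adjoin_x B" unfolding adjoin_x_eq_poly_lt using zero_poly_lt by blast
    show "(\<lambda>x. f x + g x) \<in> adjoin_x B" if "f \<in> adjoin_x B" "g \<in> adjoin_x B" for f g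
      using dir[OF that] P(3) unfolding adjoin_x_eq_poly_lt by blast
    show "(\<lambda>x. c * f x) \<in> adjoin_x B" if "f \<in> adjoin_x B" for c f
      using that P(4) unfolding adjoin_x_eq_poly_lt by blast
    show "D_op f \<in> adjoin_x B" if "f \<in> adjoin_x B" for f
      using that P(5) unfolding adjoin_x_eq_poly_lt by blast
  qed
qed

lemma poly_lt_subset_adjoin_x: "poly_lt B n \<subseteq> adjoin_x B"
  using poly_lt_Suc_mono unfolding adjoin_x_eq_poly_lt by blast

lemma subset_adjoin_x: "B \<subseteq> adjoin_x B"
  using monomial_poly_lt[of _ 0] unfolding adjoin_x_eq_poly_lt by force

text \<open>D and multiplication by x commute up to the constant 1/i, so modulo lower degree p(D)
  acts on the leading coefficient alone.\<close>

lemma poly_act_monomial: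
  assumes "f \<in> B"
  shows "\<exists>l\<in>poly_lt B n. poly_act p (\<lambda>x. f x * of_real x ^ n) = (\<lambda>x. l x + poly_act p f x * of_real x ^ n)"
  using assms
proof (induction p arbitrary: f)
  case 0
  then show ?case using zero_poly_lt by auto
next
  case (pCons c p)
  note P = D_stableD[OF D_stable_poly_lt]
  define r where "r = (\<lambda>x. - \<i> * of_nat n * f x * of_real x ^ (n - 1))"
  have r: "r \<in> poly_lt B n"
    unfolding r_def by (rule derivative_monomial_poly_lt[OF pCons.prems])
  obtain l where l: "l \<in> poly_lt B n"
    "poly_act p (\<lambda>x. D_op f x * of_real x ^ n) = (\<lambda>x. l x + poly_act p (D_op f) x * of_real x ^ n)"
    using pCons.IH[OF stableD(5)[OF pCons.prems]] by blast
  have "D_op (\<lambda>x. f x * of_real x ^ n) = (\<lambda>x. D_op f x * of_real x ^ n + r x)"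
    by (simp add: D_op_mult_power stableD(1)[OF pCons.prems] r_def algebra_simps)
  then have "poly_act p (D_op (\<lambda>x. f x * of_real x ^ n)) =
      (\<lambda>x. (l x + poly_act p (D_op f) x * of_real x ^ n) + poly_act p r x)"
    using l(2) r P(1) stableD(1,5)[OF pCons.prems]
    by (simp add: poly_act_add_right smooth_mult smooth_power smooth_of_real smooth_D_op)
  then show ?case
    using P(3)[OF l(1) poly_act_closed[OF D_stable_poly_lt r, of p]]
    by (intro bexI[of _ "\<lambda>x. l x + poly_act p r x"]) (simp_all add: poly_act_pCons algebra_simps)
qed

lemma poly_act_poly_lt_Suc:
  assumes "h \<in> poly_lt B n" "f \<in> B"
  shows "\<exists>l\<in>poly_lt B n. poly_act p (\<lambda>x. h x + f x * of_real x ^ n) = (\<lambda>x. l x + poly_act p f x * of_real x ^ n)"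
proof -
  note P = D_stableD[OF D_stable_poly_lt]
  obtain l where l: "l \<in> poly_lt B n"
    "poly_act p (\<lambda>x. f x * of_real x ^ n) = (\<lambda>x. l x + poly_act p f x * of_real x ^ n)"
    using poly_act_monomial[OF assms(2)] by blast
  have "poly_act p (\<lambda>x. h x + f x * of_real x ^ n) =
      (\<lambda>x. poly_act p h x + (l x + poly_act p f x * of_real x ^ n))"
    using P(1)[OF assms(1)] stableD(1)[OF assms(2)]
    by (simp add: poly_act_add_right smooth_mult smooth_power smooth_of_real l(2))
  then show ?thesis
    using P(3)[OF poly_act_closed[OF D_stable_poly_lt assms(1), of p] l(1)]
    by (intro bexI[of _ "\<lambda>x. poly_act p h x + l x"]) (simp_all add: algebra_simps)
qed

end

section \<open>Smooth periodic functions\<close>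

lemma Cinf_period_shift:
  assumes "f \<in> Cinf_period N" shows "f (x + 2 * pi * real N * real k) = f x"
proof (induction k)
  case (Suc k)
  have "f (x + 2 * pi * real N * real k + 2 * pi * real N) = f (x + 2 * pi * real N * real k)"
    using assms by (simp add: Cinf_period_def)
  then show ?case using Suc by (simp add: algebra_simps)
qed simp

lemma Cinf_period_mult: "f \<in> Cinf_period N \<Longrightarrow> f \<in> Cinf_period (N * M)"
  using Cinf_period_shift[of f N _ M] by (simp add: Cinf_period_def mult.assoc)

lemma has_vector_derivative_shift:
  fixes f :: "real \<Rightarrow> complex"
  assumes "(f has_vector_derivative d) (at (x + c))"
  shows "((\<lambda>x. f (x + c)) has_vector_derivative d) (at x)"
proof -
  have "((\<lambda>x. x + c) has_vector_derivative 1) (at x)" by (auto intro!: derivative_eq_intros)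
  from vector_diff_chain_at[OF this assms] show ?thesis by (simp add: o_def)
qed

lemma D_op_shift: assumes "smooth f" shows "D_op (\<lambda>x. f (x + c)) = (\<lambda>x. D_op f (x + c))"
proof (rule D_op_eqI)
  show "((\<lambda>x. f (x + c)) has_vector_derivative \<i> * D_op f (x + c)) (at x)" for x
    by (intro has_vector_derivative_shift smooth_has_vector_derivative assms)
qed

lemma D_stable_Cinf_period: "D_stable (Cinf_period N)"
proof -
  have "D_op f (x + 2 * pi * real N) = D_op f x" if "f \<in> Cinf_period N" for f x
    using fun_cong[OF D_op_shift[of f "2 * pi * real N"], of x] that by (simp add: Cinf_period_def)
  then show ?thesis
    by (auto simp: D_stable_def Cinf_period_def smooth_const smooth_add smooth_scale smooth_D_op)
qed

section \<open>Periodic exponentials and the equation (D - a) h = f\<close>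

lemma exp_2pi_eq_1_iff: "exp (2 * of_real pi * \<i> * z) = 1 \<longleftrightarrow> z \<in> \<int>"
proof
  assume "exp (2 * of_real pi * \<i> * z) = 1"
  then obtain n :: int where "2 * of_real pi * \<i> * z = of_int (2 * n) * pi * \<i>"
    using exp_eq[of "2 * of_real pi * \<i> * z" 0] by auto
  then have "z = of_int n" by simp
  then show "z \<in> \<int>" by simp
next
  assume "z \<in> \<int>"
  then obtain n where "z = of_int n" by (auto elim: Ints_cases)
  then show "exp (2 * of_real pi * \<i> * z) = 1"
    using exp_eq[of "2 * of_real pi * \<i> * z" 0] by (auto intro!: exI[of _ n])
qed

lemma exp_shift:
  "exp (\<i> * a * of_real (x + 2 * pi * real N)) =
     exp (\<i> * a * of_real x) * exp (2 * of_real pi * \<i> * (a * of_nat N))"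
  by (simp add: algebra_simps flip: exp_add)

lemma exp_mem_Cinf_period_iff:
  "(\<lambda>x. exp (\<i> * a * of_real x)) \<in> Cinf_period N \<longleftrightarrow> a * of_nat N \<in> \<int>"
  using smooth_exp[of "\<i> * a"] exp_2pi_eq_1_iff[of "a * of_nat N"]
  unfolding Cinf_period_def mem_Collect_eq exp_shift by auto

text \<open>Variation of constants: h = F exp(i a x), where F is an antiderivative of i f exp(-i a
  x) on the whole line.\<close>

lemma smooth_D_op_minus_surj:
  assumes "smooth f"
  shows "\<exists>h. smooth h \<and> (\<lambda>x. D_op h x - a * h x) = f"
proof -
  define e where "e = (\<lambda>b x. exp (b * complex_of_real x))"
  have "\<forall>x. isCont (\<lambda>x. \<i> * (f x * e (- (\<i> * a)) x)) x"
    using smooth_imp_continuous_on[OF smooth_scale[OF smooth_mult[OF assms smooth_exp[of "- (\<i> * a)"]], of "\<i>"],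
        of UNIV]
    by (simp add: continuous_on_eq_continuous_at e_def)
  then obtain F where F: "\<And>x. (F has_vector_derivative \<i> * (f x * e (- (\<i> * a)) x)) (at x)"
    using einterval_antiderivative[of "-\<infinity>" "\<infinity>" "\<lambda>x. \<i> * (f x * e (- (\<i> * a)) x)"] by auto
  define h where "h = (\<lambda>x. F x * e (\<i> * a) x)"
  have "(h has_vector_derivative (\<i> * a) * h x + \<i> * f x) (at x)" for x
  proof -
    have "e (- (\<i> * a)) x * e (\<i> * a) x = 1" by (simp add: e_def flip: exp_add)
    then have eq: "\<i> * (f x * e (- (\<i> * a)) x) * e (\<i> * a) x = \<i> * f x" by (simp add: mult.assoc)
    have "(e (\<i> * a) has_vector_derivative (\<i> * a) * e (\<i> * a) x) (at x)"
      using has_vector_derivative_exp_scaled[of "\<i> * a" x] by (simp add: e_def)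
    from has_vector_derivative_mult[OF F this]
    have "(h has_vector_derivative F x * ((\<i> * a) * e (\<i> * a) x) +
        \<i> * (f x * e (- (\<i> * a)) x) * e (\<i> * a) x) (at x)"
      unfolding h_def .
    then show ?thesis unfolding eq by (simp add: h_def ac_simps)
  qed
  note h = this
  have "smooth h" by (rule smooth_bootstrap[OF h smooth_scale[OF assms]])
  moreover have "D_op h = (\<lambda>x. a * h x + f x)"
    by (rule D_op_eqI) (use h in \<open>simp add: algebra_simps\<close>)
  ultimately show ?thesis by auto
qed

text \<open>For an arbitrary solution \<open>h\<close> on the line, \<open>h (x + 2 \<pi> N) - h x\<close> is a multiple of \<open>exp (\<i> a x)\<close>;
  subtracting a multiple of \<open>exp (\<i> a x)\<close>, or of \<open>x exp (\<i> a x)\<close> in the resonant case, makes \<open>h\<close> periodic.\<close>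

lemma Cinf_period_D_op_minus:
  assumes f: "f \<in> Cinf_period N" and N: "N \<ge> 1"
  shows "\<exists>h\<in>Cinf_period N. \<exists>c. (\<lambda>x. D_op h x - a * h x) = (\<lambda>x. f x - c * exp (\<i> * a * of_real x)) \<and>
    (c = 0 \<or> a * of_nat N \<in> \<int>)"
proof -
  define L where "L = 2 * pi * real N"
  have L: "L \<noteq> 0" using N by (simp add: L_def)
  define e where "e = (\<lambda>x. exp (\<i> * a * complex_of_real x))"
  define w where "w = exp (2 * of_real pi * \<i> * (a * of_nat N))"
  have e: "e (x + L) = e x * w" for x unfolding e_def L_def w_def by (rule exp_shift)
  have e_smooth: "smooth e" unfolding e_def by (rule smooth_exp)
  have De: "D_op e = (\<lambda>x. a * e x)" unfolding e_def by (rule D_op_exp)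
  have "smooth f" using f by (simp add: Cinf_period_def)
  then obtain h where h: "smooth h" "(\<lambda>x. D_op h x - a * h x) = f"
    using smooth_D_op_minus_surj by blast
  have Dh: "D_op h x = a * h x + f x" for x using fun_cong[OF h(2), of x] by (simp add: algebra_simps)
  have h_shift: "smooth (\<lambda>x. h (x + L))"
  \<comment> \<open>As \<open>f\<close> is periodic, the translate of \<open>h\<close> satisfies the
    same differential equation as \<open>h\<close>.\<close>
  proof (rule smooth_bootstrap[of _ "\<i> * a" "\<lambda>x. \<i> * f x"])
    show "((\<lambda>x. h (x + L)) has_vector_derivative \<i> * a * h (x + L) + \<i> * f x) (at x)" for x
      using has_vector_derivative_shift[OF smooth_has_vector_derivative[OF h(1), of "x + L"]] f
      by (simp add: Dh L_def Cinf_period_def algebra_simps)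
    show "smooth (\<lambda>x. \<i> * f x)" using f smooth_scale by (auto simp: Cinf_period_def)
  qed
  define u where "u = (\<lambda>x. h (x + L) + (- 1) * h x)"
  have "smooth u" unfolding u_def by (intro smooth_add h_shift smooth_scale h(1))
  moreover have "D_op u = (\<lambda>x. D_op h (x + L) + (- 1) * D_op h x)"
    unfolding u_def
    by (subst D_op_add[OF h_shift smooth_scale[OF h(1)]], subst D_op_scale[OF h(1)], subst D_op_shift[OF h(1)]) simp
  then have "(\<lambda>x. D_op u x - a * u x) = (\<lambda>x. 0)"
    using f by (auto simp: u_def Dh fun_eq_iff L_def Cinf_period_def algebra_simps)
  ultimately have u: "u = (\<lambda>x. u 0 * e x)"
    unfolding e_def by (rule smooth_kernel_D_op_minus)
  then have hL: "h (x + L) = h x + u 0 * e x" for x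
    using fun_cong[OF u, of x] fun_cong[OF u_def, of x] by (simp add: algebra_simps)
  show ?thesis
  proof (cases "w = 1")
    case False
    \<comment> \<open>A period shift multiplies \<open>e\<close> by \<open>w\<close>, so subtracting
      d e changes the increment of \<open>h\<close> by d (w - 1) e, which has to equal u(0)
      e.\<close>
    define d where "d = u 0 / (w - 1)"
    define k where "k = (\<lambda>x. h x + (- d) * e x)"
    have "k (x + L) = h x + e x * (u 0 - d * w)" for x
      unfolding k_def hL e by (simp add: algebra_simps)
    moreover have "u 0 - d * w = - d"
      using False by (simp add: d_def field_simps)
    ultimately have "k (x + L) = k x" for x by (simp add: k_def)
    moreover have "smooth k" unfolding k_def by (intro smooth_add h smooth_scale e_smooth)
    moreover have "D_op k = (\<lambda>x. D_op h x + (- d) * D_op e x)"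
      unfolding k_def by (subst D_op_add[OF h(1) smooth_scale[OF e_smooth]], subst D_op_scale[OF e_smooth]) simp
    then have "(\<lambda>x. D_op k x - a * k x) = f"
      by (simp add: k_def De Dh algebra_simps)
    ultimately show ?thesis
      by (intro bexI[of _ k] exI[of _ 0]) (simp_all add: Cinf_period_def L_def)
  next
    case True
    \<comment> \<open>Here \<open>e\<close> has period L, so x e(x) grows by L e(x) over a period.
      The exponent 1 below is kept explicit for \<open>D_op_mult_power\<close>.\<close>
    define d where "d = u 0 / L"
    define k where "k = (\<lambda>x. h x + (- d) * (e x * of_real x ^ 1))"
    have "k (x + L) = h x + e x * (u 0 - d * (x + L))" for x
      unfolding k_def hL e True by (simp add: algebra_simps)
    moreover have "d * of_real L = u 0" using L by (simp add: d_def)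
    then have "u 0 - d * (x + L) = - d * of_real x" for x by (simp add: distrib_left)
    ultimately have "k (x + L) = k x" for x by (simp add: k_def)
    moreover have x_smooth: "smooth (\<lambda>x. e x * of_real x ^ 1)"
      by (intro smooth_mult smooth_power smooth_of_real e_smooth)
    have "smooth k" unfolding k_def by (intro smooth_add h smooth_scale x_smooth)
    moreover have "D_op k = (\<lambda>x. D_op h x + (- d) * D_op (\<lambda>x. e x * of_real x ^ 1) x)"
      unfolding k_def by (subst D_op_add[OF h(1) smooth_scale[OF x_smooth]], subst D_op_scale[OF x_smooth]) simp
    \<comment> \<open>(D - a)(x e) = -i e, so the correction -d x e contributes i d e; hence the
      constant c = -i d.\<close>
    then have "(\<lambda>x. D_op k x - a * k x) = (\<lambda>x. f x - (- \<i> * d) * e x)"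
      by (simp only: D_op_mult_power[OF e_smooth]) (simp add: k_def De Dh algebra_simps)
    moreover have "a * of_nat N \<in> \<int>" using True unfolding w_def exp_2pi_eq_1_iff .
    ultimately show ?thesis
      unfolding e_def by (intro bexI[of _ k] exI[of _ "- \<i> * d"]) (simp_all add: Cinf_period_def L_def)
  qed
qed

lemma poly_lt_period_mult:
  "g \<in> poly_lt (Cinf_period N) n \<Longrightarrow> g \<in> poly_lt (Cinf_period (N * M)) n"
  using Cinf_period_mult[of _ N M] unfolding poly_lt_iff_sum by blast

text \<open>On the progression through x with step 2 pi N the periodic coefficients are constant, so
  \<open>g\<close> agrees there with a complex polynomial of degree below n.\<close>

lemma poly_lt_along_period:
  assumes "g \<in> poly_lt (Cinf_period N) n"
  shows "\<exists>q. (\<forall>j\<ge>n. Polynomial.coeff q j = 0) \<and>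
    (\<forall>k. g (x + 2 * pi * real N * real k) = poly q (of_real (x + 2 * pi * real N * real k)))"
  using assms
proof (induction n arbitrary: g)
  case 0
  then show ?case by (intro exI[of _ 0]) auto
next
  case (Suc n)
  obtain h f where g: "h \<in> poly_lt (Cinf_period N) n" "f \<in> Cinf_period N" "g = (\<lambda>x. h x + f x * of_real x ^ n)"
    by (rule poly_lt_SucE[OF Suc.prems])
  obtain q where q: "\<forall>j\<ge>n. Polynomial.coeff q j = 0"
    "\<And>k. h (x + 2 * pi * real N * real k) = poly q (of_real (x + 2 * pi * real N * real k))"
    using Suc.IH[OF g(1)] by blast
  show ?case
    by (rule exI[of _ "q + Polynomial.monom (f x) n"])
      (simp add: q g(3) poly_monom Cinf_period_shift[OF g(2)] del: of_real_add)
qed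

section \<open>Divisibility and kernels\<close>

text \<open>\<open>{1}\<close> gives T and \<open>{1..}\<close> gives PT. Closure under products
  supplies a common period for two functions, which makes the union of the spaces a vector
  space.\<close>

locale period_family =
  fixes \<N> :: "nat set"
  assumes nonempty: "\<N> \<noteq> {}" and ge_1: "N \<in> \<N> \<Longrightarrow> N \<ge> 1"
    and mult_mem: "N \<in> \<N> \<Longrightarrow> M \<in> \<N> \<Longrightarrow> N * M \<in> \<N>"
begin

definition \<A> :: "(real \<Rightarrow> complex) set" where
  "\<A> = (\<Union>N\<in>\<N>. Cinf_period N)"

definition frequencies :: "complex set" where
  "frequencies = {a. \<exists>N\<in>\<N>. a * of_nat N \<in> \<int>}"

lemma D_stable_\<A>: "D_stable \<A>"
  unfolding D_stable_def
proof (intro conjI ballI allI)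
  note P = D_stableD[OF D_stable_Cinf_period]
  show "\<A> \<subseteq> Collect smooth" unfolding \<A>_def using P(1) by blast
  show "(\<lambda>x. 0) \<in> \<A>" unfolding \<A>_def using P(2) nonempty by blast
  fix f assume "f \<in> \<A>"
  then obtain N where f: "N \<in> \<N>" "f \<in> Cinf_period N" by (auto simp: \<A>_def)
  show "(\<lambda>x. c * f x) \<in> \<A>" for c unfolding \<A>_def using f P(4) by blast
  show "D_op f \<in> \<A>" unfolding \<A>_def using f P(5) by blast
  fix g assume "g \<in> \<A>"
  then obtain M where g: "M \<in> \<N>" "g \<in> Cinf_period M" by (auto simp: \<A>_def)
  have "f \<in> Cinf_period (N * M)" "g \<in> Cinf_period (N * M)"
    using Cinf_period_mult[OF f(2), of M] Cinf_period_mult[OF g(2), of N] by (simp_all add: mult.commute)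
  then show "(\<lambda>x. f x + g x) \<in> \<A>" unfolding \<A>_def using P(3) mult_mem[OF f(1) g(1)] by blast
qed

sublocale D_stable_space \<A> by unfold_locales (rule D_stable_\<A>)

lemma exp_mem_\<A>_iff: "(\<lambda>x. exp (\<i> * a * of_real x)) \<in> \<A> \<longleftrightarrow> a \<in> frequencies"
  unfolding \<A>_def frequencies_def by (simp add: exp_mem_Cinf_period_iff)

lemma scaled_exp_mem_\<A>: "c = 0 \<or> a \<in> frequencies \<Longrightarrow> (\<lambda>x. c * exp (\<i> * a * of_real x)) \<in> \<A>"
  using stableD(2) stableD(4) exp_mem_\<A>_iff by auto

lemma \<A>_D_op_minus:
  assumes "f \<in> \<A>"
  shows "\<exists>h\<in>\<A>. \<exists>c. (\<lambda>x. D_op h x - a * h x) = (\<lambda>x. f x - c * exp (\<i> * a * of_real x)) \<and>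
    (c = 0 \<or> a \<in> frequencies)"
proof -
  obtain N where N: "N \<in> \<N>" "f \<in> Cinf_period N" using assms by (auto simp: \<A>_def)
  from Cinf_period_D_op_minus[OF N(2) ge_1[OF N(1)], of a] show ?thesis
    unfolding \<A>_def frequencies_def using N(1) by blast
qed

text \<open>Solving for the coefficient of x^n leaves a resonant multiple of exp(i a x) x^n and an
  error of degree n - 1. A term of degree n + 1 absorbs the first, and the induction hypothesis the
  second.\<close>

lemma monomial_D_op_minus:
  assumes "f \<in> \<A>"
  shows "\<exists>g\<in>adjoin_x \<A>. (\<lambda>x. D_op g x - a * g x) = (\<lambda>x. f x * of_real x ^ n)"
  using assms
proof (induction n arbitrary: f)
  note E = D_stableD[OF D_stable_adjoin_x]
  have step: "\<exists>h\<in>\<A>. \<exists>t\<in>adjoin_x \<A>. (\<lambda>x. D_op t x - a * t x) =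
      (\<lambda>x. f x * of_real x ^ n - \<i> * of_nat n * h x * of_real x ^ (n - 1))" if f: "f \<in> \<A>" for f n
  proof -
    obtain h c where h: "h \<in> \<A>" "(\<lambda>x. D_op h x - a * h x) = (\<lambda>x. f x - c * exp (\<i> * a * of_real x))"
      and c: "c = 0 \<or> a \<in> frequencies"
      using \<A>_D_op_minus[OF f] by blast
    \<comment> \<open>(D - a) maps exp(i a x) x^(n+1) to -i (n+1) exp(i a x) x^n, so the factor i c
      / (n+1) produces exactly the missing c exp(i a x) x^n.\<close>
    define e where "e = (\<lambda>x. \<i> * c / of_nat (Suc n) * exp (\<i> * a * complex_of_real x))"
    have e: "e \<in> \<A>" unfolding e_def using c by (intro scaled_exp_mem_\<A>) auto
    have De: "D_op e = (\<lambda>x. a * e x)"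
      unfolding e_def by (subst D_op_scale[OF smooth_exp], subst D_op_exp) (simp add: algebra_simps)
    have Dh: "D_op h x = a * h x + (f x - c * exp (\<i> * a * of_real x))" for x
      using fun_cong[OF h(2), of x] by (simp add: algebra_simps)
    define t where "t = (\<lambda>x. h x * of_real x ^ n + e x * of_real x ^ Suc n)"
    have mem: "(\<lambda>x. h x * of_real x ^ n) \<in> adjoin_x \<A>" "(\<lambda>x. e x * of_real x ^ Suc n) \<in> adjoin_x \<A>"
      using monomial_poly_lt[OF h(1)] monomial_poly_lt[OF e] poly_lt_subset_adjoin_x by blast+
    have "t \<in> adjoin_x \<A>" unfolding t_def by (rule E(3)[OF mem])
    moreover have "(\<lambda>x. D_op t x - a * t x) =
      (\<lambda>x. f x * of_real x ^ n - \<i> * of_nat n * h x * of_real x ^ (n - 1))"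
    proof
      fix x
      have D1: "D_op t x = D_op h x * of_real x ^ n - \<i> * of_nat n * h x * of_real x ^ (n - 1) +
          (D_op e x * of_real x ^ Suc n - \<i> * of_nat (Suc n) * e x * of_real x ^ n)"
        unfolding t_def
        by (subst D_op_add[OF E(1)[OF mem(1)] E(1)[OF mem(2)]])
          (simp add: D_op_mult_power stableD(1)[OF h(1)] stableD(1)[OF e] del: power_Suc)
      have D2: "\<i> * of_nat (Suc n) * e x = - c * exp (\<i> * a * complex_of_real x)"
        by (simp add: e_def del: of_nat_Suc)
      show "D_op t x - a * t x = f x * of_real x ^ n - \<i> * of_nat n * h x * of_real x ^ (n - 1)"
        unfolding D1 D2 De Dh unfolding t_def by (simp add: algebra_simps)
    qed
    ultimately show ?thesis using h(1) by blast
  qed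
  {
    case 0
    then show ?case using step[of f 0] by simp
  next
    case (Suc n)
    obtain h t where h: "h \<in> \<A>" and t: "t \<in> adjoin_x \<A>" "(\<lambda>x. D_op t x - a * t x) =
      (\<lambda>x. f x * of_real x ^ Suc n - \<i> * of_nat (Suc n) * h x * of_real x ^ n)"
      using step[OF Suc.prems, of "Suc n"] by auto
    obtain k where k: "k \<in> adjoin_x \<A>" "(\<lambda>x. D_op k x - a * k x) = (\<lambda>x. h x * of_real x ^ n)"
      using Suc.IH[OF h] by blast
    \<comment> \<open>The multiple of \<open>k\<close> whose image cancels the error term left by
      \<open>t\<close>.\<close>
    define d where "d = \<i> * of_nat (Suc n)"
    have "(\<lambda>x. t x + d * k x) \<in> adjoin_x \<A>" by (intro E(3,4) t k)
    moreover have "D_op (\<lambda>x. t x + d * k x) x - a * (t x + d * k x) = f x * of_real x ^ Suc n" for x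
      using fun_cong[OF t(2), of x, folded d_def] arg_cong[OF fun_cong[OF k(2), of x], of "\<lambda>z. d * z"]
        E(1)[OF t(1)] E(1)[OF k(1)]
      by (simp add: D_op_add D_op_scale smooth_scale algebra_simps)
    ultimately show ?case by blast
  }
qed

lemma D_divisible_adjoin_x: "D_divisible (adjoin_x \<A>)"
proof -
  note E = D_stableD[OF D_stable_adjoin_x]
  have "\<exists>k\<in>adjoin_x \<A>. (\<lambda>x. D_op k x - a * k x) = g" if "g \<in> poly_lt \<A> n" for a g n
    using that
  proof (induction n arbitrary: g)
    case 0
    then show ?case using E(2) by (intro bexI[of _ "\<lambda>x. 0"]) (auto simp: D_op_const)
  next
    case (Suc n)
    then obtain h f where g: "h \<in> poly_lt \<A> n" "f \<in> \<A>" "g = (\<lambda>x. h x + f x * of_real x ^ n)"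
      by (elim poly_lt_SucE)
    obtain k where k: "k \<in> adjoin_x \<A>" "(\<lambda>x. D_op k x - a * k x) = h"
      using Suc.IH[OF g(1)] by blast
    obtain l where l: "l \<in> adjoin_x \<A>" "(\<lambda>x. D_op l x - a * l x) = (\<lambda>x. f x * of_real x ^ n)"
      using monomial_D_op_minus[OF g(2)] by blast
    have "D_op (\<lambda>x. k x + l x) x - a * (k x + l x) = g x" for x
      using fun_cong[OF k(2), of x] fun_cong[OF l(2), of x] E(1)[OF k(1)] E(1)[OF l(1)]
      by (simp add: D_op_add g(3) algebra_simps)
    then show ?case using E(3)[OF k(1) l(1)] by blast
  qed
  then show ?thesis unfolding D_divisible_def adjoin_x_eq_poly_lt by blast
qed

section \<open>Independence of x over the periodic functions, and kernels of D - a\<close>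

lemma poly_lt_common_period:
  assumes "g \<in> poly_lt \<A> n"
  shows "\<exists>N\<in>\<N>. g \<in> poly_lt (Cinf_period N) n"
  using assms
proof (induction n arbitrary: g)
  case 0
  then show ?case using nonempty by auto
next
  case (Suc n)
  obtain h f where g: "h \<in> poly_lt \<A> n" "f \<in> \<A>" "g = (\<lambda>x. h x + f x * of_real x ^ n)"
    by (rule poly_lt_SucE[OF Suc.prems])
  obtain N where N: "N \<in> \<N>" "h \<in> poly_lt (Cinf_period N) n" using Suc.IH[OF g(1)] by blast
  obtain M where M: "M \<in> \<N>" "f \<in> Cinf_period M" using g(2) by (auto simp: \<A>_def)
  have "h \<in> poly_lt (Cinf_period (N * M)) n"
    by (rule poly_lt_period_mult[OF N(2)])
  moreover have "f \<in> Cinf_period (N * M)"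
    using Cinf_period_mult[OF M(2), of N] by (simp add: mult.commute)
  ultimately show ?case using poly_lt_SucI mult_mem[OF N(1) M(1)] g(3) by blast
qed

text \<open>At the points x + 2 pi N M k the identity says that a fixed complex polynomial vanishes.
  Its coefficient of index n is u(x), and it has infinitely many zeros.\<close>

lemma poly_lt_top_coeff_zero:
  assumes l: "l \<in> poly_lt \<A> n" and u: "u \<in> \<A>" and zero: "(\<lambda>x. l x + u x * of_real x ^ n) = (\<lambda>x. 0)"
  shows "u = (\<lambda>x. 0)"
proof
  fix x
  obtain N where N: "N \<in> \<N>" "l \<in> poly_lt (Cinf_period N) n" using poly_lt_common_period[OF l] by blast
  obtain M where M: "M \<in> \<N>" "u \<in> Cinf_period M" using u by (auto simp: \<A>_def)
  have l': "l \<in> poly_lt (Cinf_period (N * M)) n" by (rule poly_lt_period_mult[OF N(2)])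
  have u': "u \<in> Cinf_period (N * M)" using Cinf_period_mult[OF M(2), of N] by (simp add: mult.commute)
  define z where "z k = x + 2 * pi * real (N * M) * real k" for k
  define y where "y k = complex_of_real (z k)" for k
  obtain q where q: "\<forall>j\<ge>n. Polynomial.coeff q j = 0"
    "\<And>k. l (z k) = poly q (y k)"
    using poly_lt_along_period[OF l', of x] unfolding y_def z_def by blast
  define r where "r = q + Polynomial.monom (u x) n"
  have "poly r (y k) = 0" for k
    using fun_cong[OF zero, of "z k"] Cinf_period_shift[OF u', of x k, folded z_def]
    by (simp add: r_def poly_monom q(2) flip: y_def)
  moreover have "N * M \<noteq> 0" using ge_1 N(1) M(1) by fastforce
  then have "inj y" by (auto simp: inj_def y_def z_def simp flip: of_real_mult of_real_add)
  then have "infinite (range y)" using range_inj_infinite by blast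
  moreover have "range y \<subseteq> {z. poly r z = 0}" using calculation(1) by auto
  ultimately have "r = 0" using poly_roots_finite finite_subset by blast
  then have "Polynomial.coeff r n = 0" by simp
  then show "u x = 0" using q(1) by (simp add: r_def)
qed

text \<open>The leading coefficient of a kernel element lies in the kernel too, hence is a multiple
  of exp(i a x). If it is nonzero, this exponential belongs to \<A>; if it is zero, the degree
  drops.\<close>

lemma kernel_imp_frequency:
  assumes "g \<in> poly_lt \<A> n" "(\<lambda>x. D_op g x - a * g x) = (\<lambda>x. 0)" "g \<noteq> (\<lambda>x. 0)"
  shows "a \<in> frequencies"
  using assms
proof (induction n arbitrary: g)
  case (Suc n)
  obtain h f where g: "h \<in> poly_lt \<A> n" "f \<in> \<A>" "g = (\<lambda>x. h x + f x * of_real x ^ n)"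
    by (rule poly_lt_SucE[OF Suc.prems(1)])
  obtain l where l: "l \<in> poly_lt \<A> n"
    "poly_act [:- a, 1:] g = (\<lambda>x. l x + poly_act [:- a, 1:] f x * of_real x ^ n)"
    using poly_act_poly_lt_Suc[OF g(1,2), of "[:- a, 1:]"] g(3) by blast
  have "poly_act [:- a, 1:] f = (\<lambda>x. 0)"
    using l Suc.prems(2) poly_act_linear_factor[of a g]
    by (intro poly_lt_top_coeff_zero[OF l(1) poly_act_closed[OF D_stable_\<A> g(2)]]) simp
  then have f: "f = (\<lambda>x. f 0 * exp (\<i> * a * of_real x))"
    unfolding poly_act_linear_factor by (intro smooth_kernel_D_op_minus stableD(1) g(2))
  show ?case
  proof (cases "f 0 = 0")
    case True
    then have "g = h" using f g(3) by (auto simp: fun_eq_iff)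
    then show ?thesis using Suc.IH[OF g(1)] Suc.prems by simp
  next
    case False
    have "(\<lambda>x. 1 / f 0 * f x) \<in> \<A>" by (rule stableD(4)[OF g(2)])
    moreover have "1 / f 0 * f x = exp (\<i> * a * of_real x)" for x
      using fun_cong[OF f, of x] False by (simp add: field_simps)
    ultimately show ?thesis using exp_mem_\<A>_iff by simp
  qed
qed simp

lemma kernel_D_op_minus:
  assumes "g \<in> adjoin_x \<A>" "(\<lambda>x. D_op g x - a * g x) = (\<lambda>x. 0)"
  shows "g = (\<lambda>x. g 0 * exp (\<i> * a * of_real x))" "g 0 = 0 \<or> a \<in> frequencies"
proof -
  show *: "g = (\<lambda>x. g 0 * exp (\<i> * a * of_real x))"
    by (rule smooth_kernel_D_op_minus[OF D_stableD(1)[OF D_stable_adjoin_x assms(1)] assms(2)])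
  show "g 0 = 0 \<or> a \<in> frequencies"
    using kernel_imp_frequency[OF _ assms(2)] assms(1) unfolding adjoin_x_eq_poly_lt
    by (metis UN_E)
qed

lemma kernel_D_op_minus_eq:
  assumes "a \<in> frequencies"
  shows "{f \<in> adjoin_x \<A>. (\<lambda>x. D_op f x - a * f x) = (\<lambda>x. 0)} =
    {(\<lambda>x. c * exp (\<i> * a * of_real x)) | c. True}"
proof (intro equalityI subsetI)
  fix f assume "f \<in> {f \<in> adjoin_x \<A>. (\<lambda>x. D_op f x - a * f x) = (\<lambda>x. 0)}"
  then show "f \<in> {(\<lambda>x. c * exp (\<i> * a * of_real x)) | c. True}"
    using kernel_D_op_minus(1) by blast
next
  fix f assume "f \<in> {(\<lambda>x. c * exp (\<i> * a * of_real x)) | c. True}"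
  then obtain c where f: "f = (\<lambda>x. c * exp (\<i> * a * of_real x))" by blast
  have "D_op f = (\<lambda>x. a * f x)"
    unfolding f by (subst D_op_scale[OF smooth_exp], subst D_op_exp) (simp add: algebra_simps)
  moreover have "f \<in> adjoin_x \<A>"
    unfolding f using scaled_exp_mem_\<A> assms subset_adjoin_x by blast
  ultimately show "f \<in> {f \<in> adjoin_x \<A>. (\<lambda>x. D_op f x - a * f x) = (\<lambda>x. 0)}" by simp
qed

lemma bij_betw_D_op_minus:
  assumes "a \<notin> frequencies"
  shows "bij_betw (\<lambda>f x. D_op f x - a * f x) (adjoin_x \<A>) (adjoin_x \<A>)"
  unfolding bij_betw_def
proof
  note E = D_stableD[OF D_stable_adjoin_x]
  show "inj_on (\<lambda>f x. D_op f x - a * f x) (adjoin_x \<A>)"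
  proof (rule inj_onI)
    fix f g assume fg: "f \<in> adjoin_x \<A>" "g \<in> adjoin_x \<A>"
      and eq: "(\<lambda>x. D_op f x - a * f x) = (\<lambda>x. D_op g x - a * g x)"
    have "poly_act [:- a, 1:] (\<lambda>x. f x - g x) = (\<lambda>x. 0)"
      using eq E(1)[OF fg(1)] E(1)[OF fg(2)]
      by (subst poly_act_diff_right) (simp_all only: poly_act_linear_factor fun_eq_iff, simp)
    note ker = kernel_D_op_minus[OF D_stable_diff[OF D_stable_adjoin_x fg] this[unfolded poly_act_linear_factor]]
    have zero: "f 0 - g 0 = 0" using ker(2) assms by simp
    have "f x - g x = 0" for x using fun_cong[OF ker(1), of x] unfolding zero by simp
    then show "f = g" by (simp add: fun_eq_iff)
  qed
  have "(\<lambda>x. D_op f x - a * f x) \<in> adjoin_x \<A>" if "f \<in> adjoin_x \<A>" for f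
    using poly_act_closed[OF D_stable_adjoin_x that] poly_act_linear_factor by metis
  moreover have "g \<in> (\<lambda>f x. D_op f x - a * f x) ` adjoin_x \<A>" if g: "g \<in> adjoin_x \<A>" for g
  proof -
    obtain h where "h \<in> adjoin_x \<A>" "(\<lambda>x. D_op h x - a * h x) = g"
      using D_divisible_adjoin_x g unfolding D_divisible_def by blast
    then show ?thesis by (intro image_eqI[of _ _ h]) simp_all
  qed
  ultimately show "(\<lambda>f x. D_op f x - a * f x) ` adjoin_x \<A> = adjoin_x \<A>" by blast
qed

sublocale D_divisible_extension \<A> "adjoin_x \<A>"
proof
  show "g \<in> \<A>" if "g \<in> adjoin_x \<A>" "(\<lambda>x. D_op g x - a * g x) = (\<lambda>x. 0)" for a g
    using kernel_D_op_minus[OF that] scaled_exp_mem_\<A> by metis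
qed (rule D_stable_\<A> D_stable_adjoin_x subset_adjoin_x D_divisible_adjoin_x)+

end

section \<open>Fourier coefficients\<close>

lemma smooth_integrable: "smooth f \<Longrightarrow> f integrable_on {a..b}"
  by (intro integrable_continuous_interval smooth_imp_continuous_on)

lemma fourier_coeff_add:
  assumes "smooth f" "smooth g"
  shows "fourier_coeff N (\<lambda>x. f x + g x) a = fourier_coeff N f a + fourier_coeff N g a"
  using smooth_integrable[OF smooth_mult[OF assms(1) smooth_exp[of "- \<i> * a"]]]
    smooth_integrable[OF smooth_mult[OF assms(2) smooth_exp[of "- \<i> * a"]]]
  unfolding fourier_coeff_def by (simp add: ring_distribs integral_add add_divide_distrib)

lemma fourier_coeff_scale: "fourier_coeff N (\<lambda>x. c * f x) a = c * fourier_coeff N f a"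
  unfolding fourier_coeff_def by (simp add: mult.assoc)

text \<open>Integration by parts over one period; the boundary terms cancel because N a is an
  integer and the exponential is therefore periodic as well.\<close>

lemma fourier_coeff_D_op:
  assumes f: "f \<in> Cinf_period N" and a: "real N * a \<in> \<int>"
  shows "fourier_coeff N (D_op f) a = of_real a * fourier_coeff N f a"
proof -
  define L where "L = 2 * pi * real N"
  define e where "e = (\<lambda>x. exp (- \<i> * of_real a * complex_of_real x))"
  have f': "smooth f" using f by (simp add: Cinf_period_def)
  have e': "smooth e" unfolding e_def by (rule smooth_exp)
  obtain k where k: "real N * a = of_int k" using a by (auto elim: Ints_cases)
  have "- of_real a * of_nat N = - complex_of_real (real N * a)" by simp
  then have "- of_real a * of_nat N = (of_int (- k) :: complex)" by (simp only: k of_int_minus of_real_of_int_eq)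
  then have "- of_real a * of_nat N \<in> (\<int> :: complex set)" by (simp only: Ints_of_int)
  then have "(\<lambda>x. exp (\<i> * (- of_real a) * complex_of_real x)) \<in> Cinf_period N"
    unfolding exp_mem_Cinf_period_iff .
  also have "(\<lambda>x. exp (\<i> * (- of_real a) * complex_of_real x)) = e" by (simp add: e_def)
  finally have "e (0 + L) = e 0" unfolding Cinf_period_def L_def by blast
  moreover have "f (0 + L) = f 0" using f unfolding Cinf_period_def L_def by blast
  ultimately have ends: "f L * e L = f 0 * e 0" by simp
  have "((\<lambda>x. f x * e x) has_vector_derivative \<i> * (D_op f x * e x - of_real a * (f x * e x))) (at x)" for x
    using has_vector_derivative_mult[OF smooth_has_vector_derivative[OF f', of x]
        has_vector_derivative_exp_scaled[of "- \<i> * a" x]]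
    unfolding e_def by (simp add: algebra_simps)
  then have "((\<lambda>x. \<i> * (D_op f x * e x - of_real a * (f x * e x))) has_integral f L * e L - f 0 * e 0) {0..L}"
    by (intro fundamental_theorem_of_calculus) (auto simp: L_def intro: has_vector_derivative_at_within)
  then have "integral {0..L} (\<lambda>x. D_op f x * e x - of_real a * (f x * e x)) = 0"
    using ends by (auto dest!: integral_unique)
  moreover have "integral {0..L} (\<lambda>x. D_op f x * e x - of_real a * (f x * e x)) =
      integral {0..L} (\<lambda>x. D_op f x * e x) - integral {0..L} (\<lambda>x. of_real a * (f x * e x))"
    by (intro integral_diff smooth_integrable smooth_mult smooth_scale smooth_D_op f' e')
  ultimately have "integral {0..L} (\<lambda>x. D_op f x * e x) = of_real a * integral {0..L} (\<lambda>x. f x * e x)"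
    by simp
  then show ?thesis unfolding fourier_coeff_def e_def L_def by simp
qed

lemma fourier_coeff_poly_act:
  assumes "f \<in> Cinf_period N" "real N * a \<in> \<int>"
  shows "fourier_coeff N (poly_act p f) a = poly p (of_real a) * fourier_coeff N f a"
  using assms(1)
proof (induction p arbitrary: f)
  case 0
  then show ?case by (simp add: fourier_coeff_def)
next
  case (pCons c p)
  note P = D_stableD[OF D_stable_Cinf_period]
  have "fourier_coeff N (poly_act (pCons c p) f) a =
      c * fourier_coeff N f a + fourier_coeff N (poly_act p (D_op f)) a"
    using pCons.prems P(1)[OF pCons.prems]
    by (simp add: poly_act_pCons fourier_coeff_add fourier_coeff_scale smooth_scale smooth_poly_act smooth_D_op)
  also have "fourier_coeff N (poly_act p (D_op f)) a = poly p (of_real a) * (of_real a * fourier_coeff N f a)"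
    using pCons.IH[OF P(5)[OF pCons.prems]] fourier_coeff_D_op[OF pCons.prems assms(2)] by simp
  finally show ?case by (simp add: algebra_simps)
qed

text \<open>\<open>f\<close> descends to a function on the unit circle along x -> exp(i x /
  N).\<close>

lemma Cinf_period_cong:
  assumes f: "f \<in> Cinf_period N" and N: "N \<ge> 1"
    and eq: "exp (\<i> * of_real (x / real N)) = exp (\<i> * of_real (y / real N))"
  shows "f x = f y"
proof -
  have "f (z + 2 * pi * real N * of_int k) = f z" for z k
  proof (cases "k \<ge> 0")
    case True
    then show ?thesis using Cinf_period_shift[OF f, of z "nat k"] by simp
  next
    case False
    then show ?thesis using Cinf_period_shift[OF f, of "z + 2 * pi * real N * of_int k" "nat (- k)"] by simp
  qed
  moreover obtain k :: int where "\<i> * of_real (x / real N) = \<i> * of_real (y / real N) + of_int (2 * k) * pi * \<i>"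
    using eq unfolding exp_eq by blast
  then have "Im (\<i> * of_real (x / real N)) = Im (\<i> * of_real (y / real N) + of_int (2 * k) * pi * \<i>)" by simp
  then have "x / real N = y / real N + of_int (2 * k) * pi" by simp
  then have "x = y + 2 * pi * real N * of_int k" using N by (simp add: field_simps)
  ultimately show ?thesis by simp
qed

text \<open>\<open>Arg2pi\<close> jumps across the positive real axis and \<open>Arg\<close> across
  the negative one. By periodicity both give the same value of \<open>f\<close>, and at each point
  of the circle one of them is continuous.\<close>

lemma continuous_on_circle_Cinf_period:
  assumes f: "f \<in> Cinf_period N" and N: "N \<ge> 1"
  shows "continuous_on (sphere 0 1) (\<lambda>z. f (real N * Arg2pi z))"
proof -
  have isCont: "isCont f x" for x
    using f smooth_imp_continuous_on[of f UNIV] by (simp add: Cinf_period_def continuous_on_eq_continuous_at)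
  have eq: "f (real N * Arg2pi z) = f (real N * Arg z)" if "z \<in> sphere 0 1" for z
  proof (rule Cinf_period_cong[OF f N])
    have "exp (\<i> * of_real (Arg2pi z)) = z" using that complex_norm_eq_1_exp[of z] by simp
    moreover have "exp (\<i> * of_real (Arg z)) = z" using that Arg_eq[of z] by force
    ultimately show "exp (\<i> * of_real (real N * Arg2pi z / real N)) = exp (\<i> * of_real (real N * Arg z / real N))"
      using N by simp
  qed
  show ?thesis
    unfolding continuous_on_eq_continuous_within
  proof
    fix z :: complex assume z: "z \<in> sphere 0 1"
    show "continuous (at z within sphere 0 1) (\<lambda>z. f (real N * Arg2pi z))"
    proof (cases "z \<in> \<real>\<^sub>\<ge>\<^sub>0")
      case False
      then have "isCont (\<lambda>z. f (real N * Arg2pi z)) z"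
        by (intro isCont_o2[OF _ isCont] continuous_intros continuous_at_Arg2pi)
      then show ?thesis by (rule continuous_at_imp_continuous_at_within)
    next
      case True
      moreover have "z \<noteq> 0" using z by auto
      ultimately have "z \<notin> \<real>\<^sub>\<le>\<^sub>0"
        by (auto simp: complex_nonneg_Reals_iff complex_nonpos_Reals_iff complex_eq_iff)
      then have "isCont (\<lambda>z. f (real N * Arg z)) z"
        by (intro isCont_o2[OF _ isCont] continuous_intros continuous_at_Arg)
      then have "continuous (at z within sphere 0 1) (\<lambda>z. f (real N * Arg z))"
        by (rule continuous_at_imp_continuous_at_within)
      then show ?thesis
        by (rule continuous_transform_within[OF _ zero_less_one z]) (simp add: eq)
    qed
  qed
qed

text \<open>The exponentials carry the sign used in \<open>fourier_coeff\<close>, so integrating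
  \<open>f\<close> against a generator gives a multiple of a Fourier coefficient.\<close>

inductive trig_poly :: "nat \<Rightarrow> (real \<Rightarrow> complex) \<Rightarrow> bool" for N where
  exp: "real N * a \<in> \<int> \<Longrightarrow> trig_poly N (\<lambda>x. c * exp (- \<i> * of_real a * of_real x))"
| add: "trig_poly N f \<Longrightarrow> trig_poly N g \<Longrightarrow> trig_poly N (\<lambda>x. f x + g x)"

lemma trig_poly_const: "trig_poly N (\<lambda>x. c)"
  using trig_poly.exp[of N 0 c] by simp

lemma trig_poly_mult:
  assumes "trig_poly N f" "trig_poly N g"
  shows "trig_poly N (\<lambda>x. f x * g x)"
  using assms(1)
proof induction
  case f: (exp a c)
  show ?case
    using assms(2)
  proof induction
    case (exp b d)
    have "real N * (a + b) \<in> \<int>" using f exp by (simp add: ring_distribs)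
    from trig_poly.exp[OF this, of "c * d"]
    show ?case by (simp add: algebra_simps flip: exp_add)
  next
    case (add g h)
    from trig_poly.add[OF add.IH] show ?case by (simp add: algebra_simps)
  qed
next
  case (add f h)
  from trig_poly.add[OF add.IH] show ?case by (simp add: algebra_simps)
qed

lemma smooth_trig_poly: "trig_poly N g \<Longrightarrow> smooth g"
proof (induction rule: trig_poly.induct)
  case (exp a c)
  show ?case by (intro smooth_scale smooth_exp)
qed (rule smooth_add)

text \<open>On the circle the conjugate of exp(i x / N) is again an exponential, so real-linear
  functionals give trigonometric polynomials; sums and products preserve these.\<close>

lemma trig_poly_real_polynomial_function:
  fixes p :: "complex \<Rightarrow> real"
  assumes "real_polynomial_function p" "N \<ge> 1"
  shows "trig_poly N (\<lambda>x. of_real (p (exp (\<i> * of_real (x / real N)))))"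
  using assms(1)
proof induction
  case (linear p)
  then interpret bounded_linear p .
  define E where "E = (\<lambda>x. exp (\<i> * complex_of_real (x / real N)))"
  \<comment> \<open>From p(z) = Re z p(1) + Im z p(i), with real and imaginary parts expressed
    through z and its conjugate.\<close>
  define \<alpha> \<beta> where "\<alpha> = (of_real (p 1) - \<i> * of_real (p \<i>)) / 2" and "\<beta> = (of_real (p 1) + \<i> * of_real (p \<i>)) / 2"
  have "of_real (p z) = \<alpha> * z + \<beta> * cnj z" for z
  proof -
    have "z = Re z *\<^sub>R 1 + Im z *\<^sub>R \<i>" by (simp add: complex_eq_iff)
    then have "p z = Re z * p 1 + Im z * p \<i>" by (metis add scale real_scaleR_def)
    then show ?thesis by (simp add: \<alpha>_def \<beta>_def complex_eq_iff field_simps)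
  qed
  moreover have "cnj (E x) = exp (- \<i> * of_real (1 / real N) * of_real x)" for x
    by (simp add: E_def exp_cnj)
  moreover have "E x = exp (- \<i> * of_real (- 1 / real N) * of_real x)" for x
    by (simp add: E_def)
  ultimately have "of_real (p (E x)) = \<alpha> * exp (- \<i> * of_real (- 1 / real N) * of_real x) +
      \<beta> * exp (- \<i> * of_real (1 / real N) * of_real x)" for x
    by metis
  moreover have "trig_poly N (\<lambda>x. \<alpha> * exp (- \<i> * of_real (- 1 / real N) * of_real x) +
      \<beta> * exp (- \<i> * of_real (1 / real N) * of_real x))"
    using assms(2) by (intro trig_poly.intros) auto
  ultimately show ?case by (simp add: E_def)
next
  case (const c)
  show ?case by (rule trig_poly_const)
next
  case (add p q)
  then show ?case using trig_poly.add by fastforce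
next
  case (mult p q)
  then show ?case using trig_poly_mult by fastforce
qed

lemma trig_poly_polynomial_function:
  fixes q :: "complex \<Rightarrow> complex"
  assumes "polynomial_function q" "N \<ge> 1"
  shows "trig_poly N (\<lambda>x. q (exp (\<i> * of_real (x / real N))))"
proof -
  have "real_polynomial_function (Re \<circ> q)" "real_polynomial_function (Im \<circ> q)"
    using assms(1) bounded_linear_Re bounded_linear_Im unfolding polynomial_function_def by blast+
  from trig_poly.add[OF trig_poly_real_polynomial_function[OF this(1) assms(2)]
      trig_poly_mult[OF trig_poly_const[of N \<i>] trig_poly_real_polynomial_function[OF this(2) assms(2)]]]
  show ?thesis by (simp add: complex_eq[symmetric])
qed

lemma integral_mult_trig_poly_eq_0:
  assumes f: "f \<in> Cinf_period N" and N: "N \<ge> 1"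
    and zero: "\<And>a. real N * a \<in> \<int> \<Longrightarrow> fourier_coeff N f a = 0"
    and g: "trig_poly N g"
  shows "integral {0..2 * pi * real N} (\<lambda>x. f x * g x) = 0"
  using g
proof induction
  case (exp a c)
  have "integral {0..2 * pi * real N} (\<lambda>x. f x * exp (- \<i> * of_real a * of_real x)) = 0"
    using zero[OF exp] N by (simp add: fourier_coeff_def)
  then have "integral {0..2 * pi * real N} (\<lambda>x. c * (f x * exp (- \<i> * of_real a * of_real x))) = 0"
    by (subst integral_mult_right) simp
  then show ?case by (simp add: mult.left_commute)
next
  case (add g h)
  have "smooth f" using f by (simp add: Cinf_period_def)
  then have "(\<lambda>x. f x * g x) integrable_on {0..2 * pi * real N}"
    "(\<lambda>x. f x * h x) integrable_on {0..2 * pi * real N}"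
    using add.hyps[THEN smooth_trig_poly] by (auto intro!: smooth_integrable smooth_mult)
  then show ?case using add.IH by (simp add: distrib_left integral_add)
qed

text \<open>\<open>f\<close> is orthogonal to all trigonometric polynomials, and by
  Stone-Weierstrass on the circle these approximate the conjugate of \<open>f\<close> uniformly.
  Hence the integral of |f|^2 over a period vanishes.\<close>

lemma fourier_coeff_zero_imp_zero:
  assumes f: "f \<in> Cinf_period N" and N: "N \<ge> 1"
    and zero: "\<And>a. real N * a \<in> \<int> \<Longrightarrow> fourier_coeff N f a = 0"
  shows "f = (\<lambda>x. 0)"
proof -
  define L where "L = 2 * pi * real N"
  have L: "L > 0" using N by (simp add: L_def)
  define E where "E = (\<lambda>x. exp (\<i> * complex_of_real (x / real N)))"
  have smooth: "smooth f" using f by (simp add: Cinf_period_def)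
  note cont = smooth_imp_continuous_on[OF smooth]
  have E: "f (real N * Arg2pi (E x)) = f x" for x
  proof (rule Cinf_period_cong[OF f N])
    have "norm (E x) = 1" by (simp add: E_def)
    then show "exp (\<i> * of_real (real N * Arg2pi (E x) / real N)) = exp (\<i> * of_real (x / real N))"
      using complex_norm_eq_1_exp[of "E x"] N by (simp add: E_def)
  qed
  obtain B where "\<forall>y\<in>f ` {0..L}. norm y \<le> B"
    using compact_imp_bounded[OF compact_continuous_image[OF cont compact_Icc, of 0 L]]
    unfolding bounded_iff by blast
  then have B: "norm (f x) \<le> B" if "x \<in> {0..L}" for x using that by blast
  have B0: "B \<ge> 0" using order_trans[OF norm_ge_zero B[of 0]] L by simp
  define I where "I = integral {0..L} (\<lambda>x. f x * cnj (f x))"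
  have small: "norm I \<le> e * (B * L)" if e: "e > 0" for e
  proof -
    have "continuous_on (sphere 0 1) (\<lambda>z. cnj (f (real N * Arg2pi z)))"
      by (intro continuous_on_cnj continuous_on_circle_Cinf_period f N)
    from Stone_Weierstrass_polynomial_function[OF compact_sphere this e]
    obtain q :: "complex \<Rightarrow> complex" where q: "polynomial_function q"
      "\<And>z. z \<in> sphere 0 1 \<Longrightarrow> norm (cnj (f (real N * Arg2pi z)) - q z) < e"
      by auto
    have trig: "trig_poly N (\<lambda>x. q (E x))"
      unfolding E_def by (rule trig_poly_polynomial_function[OF q(1) N])
    have close: "norm (cnj (f x) - q (E x)) \<le> e" for x
      using q(2)[of "E x"] E[of x] by (simp add: E_def less_imp_le)
    have cont_q: "continuous_on {0..L} (\<lambda>x. q (E x))"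
      by (rule smooth_imp_continuous_on[OF smooth_trig_poly[OF trig]])
    have "integral {0..L} (\<lambda>x. f x * (cnj (f x) - q (E x))) =
        I - integral {0..L} (\<lambda>x. f x * q (E x))"
      unfolding I_def right_diff_distrib
      by (intro integral_diff integrable_continuous_interval continuous_intros continuous_on_cnj cont cont_q)
    also have "integral {0..L} (\<lambda>x. f x * q (E x)) = 0"
      unfolding L_def by (rule integral_mult_trig_poly_eq_0[OF f N zero trig])
    finally have "I = integral {0..L} (\<lambda>x. f x * (cnj (f x) - q (E x)))" by simp
    also have "norm \<dots> \<le> (B * e) * (L - 0)"
    proof (rule integral_bound)
      show "continuous_on {0..L} (\<lambda>x. f x * (cnj (f x) - q (E x)))"
        by (intro continuous_intros continuous_on_cnj cont cont_q)
      show "norm (f x * (cnj (f x) - q (E x))) \<le> B * e" if "x \<in> {0..L}" for x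
        unfolding norm_mult using B[OF that] close B0 by (intro mult_mono) auto
    qed (use L in simp)
    finally show ?thesis by (simp add: algebra_simps)
  qed
  have "norm I \<le> 0"
  proof (rule field_le_epsilon)
    fix \<epsilon> :: real assume "\<epsilon> > 0"
    moreover have "B * L \<ge> 0" using B0 L by simp
    \<comment> \<open>The added 1 keeps the denominator positive when \<open>B = 0\<close>.\<close>
    ultimately have "norm I \<le> \<epsilon> / (B * L + 1) * (B * L)" by (intro small) auto
    also have "\<dots> \<le> \<epsilon>" using \<open>\<epsilon> > 0\<close> \<open>B * L \<ge> 0\<close> by (simp add: field_simps)
    finally show "norm I \<le> 0 + \<epsilon>" by simp
  qed
  moreover have "I = of_real (integral {0..L} (\<lambda>x. (norm (f x))\<^sup>2))"
  proof -
    have "((\<lambda>x. (norm (f x))\<^sup>2) has_integral integral {0..L} (\<lambda>x. (norm (f x))\<^sup>2)) {0..L}"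
      by (intro integrable_integral integrable_continuous_interval continuous_intros cont)
    from has_integral_of_real[OF this, where ?'b = complex] show ?thesis
      unfolding I_def by (intro integral_unique) (simp only: complex_norm_square)
  qed
  ultimately have "integral {0..L} (\<lambda>x. (norm (f x))\<^sup>2) = 0" by simp
  then have "\<forall>x\<in>{0..L}. (norm (f x))\<^sup>2 = 0"
    using L by (subst (asm) integral_eq_0_iff) (auto intro!: continuous_intros cont)
  \<comment> \<open>Every value of \<open>f\<close> is attained on one period, so vanishing there
    suffices.\<close>
  moreover have "real N * Arg2pi (E x) \<in> {0..L}" for x
    using Arg2pi_ge_0[of "E x"] Arg2pi_lt_2pi[of "E x"] N by (auto simp: L_def mult.commute)
  ultimately have "f x = 0" for x using E[of x] by (metis norm_eq_zero zero_eq_power2)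
  then show ?thesis by auto
qed

section \<open>The torsion closure\<close>

text \<open>p(a) times the coefficient at a is zero, so the support consists of real roots of
  \<open>p\<close>, whichever period is used.\<close>

lemma finite_fourier_support_if_annihilated:
  assumes "p \<noteq> 0" "poly_act p f = (\<lambda>x. 0)"
  shows "finite (fourier_support f)"
proof (rule finite_subset)
  show "fourier_support f \<subseteq> of_real -` {z. poly p z = 0}"
  proof
    fix a assume "a \<in> fourier_support f"
    then obtain N where N: "f \<in> Cinf_period N" "real N * a \<in> \<int>" "fourier_coeff N f a \<noteq> 0"
      by (auto simp: fourier_support_def)
    have "poly p (of_real a) * fourier_coeff N f a = fourier_coeff N (\<lambda>x. 0) a"
      using fourier_coeff_poly_act[OF N(1,2), of p] assms(2) by simp
    then show "a \<in> of_real -` {z. poly p z = 0}" using N(3) by (simp add: fourier_coeff_def)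
  qed
  show "finite (of_real -` {z. poly p z = 0})"
    by (intro finite_vimageI poly_roots_finite assms) (simp add: inj_def)
qed

text \<open>The product of D - a over the support kills every Fourier coefficient, hence the
  function by \<open>fourier_coeff_zero_imp_zero\<close>.\<close>

lemma annihilated_if_finite_fourier_support:
  assumes f: "f \<in> Cinf_period N" and N: "N \<ge> 1" and fin: "finite (fourier_support f)"
  shows "\<exists>p. p \<noteq> 0 \<and> poly_act p f = (\<lambda>x. 0)"
proof (intro exI conjI)
  define p where "p = (\<Prod>a\<in>fourier_support f. [:- complex_of_real a, 1:])"
  show "p \<noteq> 0" using fin by (simp add: p_def)
  show "poly_act p f = (\<lambda>x. 0)"
  proof (rule fourier_coeff_zero_imp_zero[OF poly_act_closed[OF D_stable_Cinf_period f] N])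
    fix a assume a: "real N * a \<in> \<int>"
    have "poly p (of_real a) = 0 \<or> fourier_coeff N f a = 0"
    proof (cases "a \<in> fourier_support f")
      case True
      then show ?thesis using fin by (auto simp: p_def poly_prod)
    next
      case False
      then show ?thesis using f N a by (auto simp: fourier_support_def)
    qed
    then show "fourier_coeff N (poly_act p f) a = 0" using fourier_coeff_poly_act[OF f a] by auto
  qed
qed

context period_family begin

text \<open>The functions killed by p(D) form a D-stable space \<open>B\<close>, and p(D) lowers the
  degree in x on B[x]; in effect p^(n+1) annihilates f x^n. Torsion-freeness modulo the closure
  replaces the explicit power.\<close>

lemma annihilated_monomial_mem_torsion_closure:
  assumes f: "f \<in> \<A>" and p: "p \<noteq> 0" "poly_act p f = (\<lambda>x. 0)"
  shows "(\<lambda>x. f x * of_real x ^ n) \<in> torsion_closure \<A> (adjoin_x \<A>)"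
proof -
  define B where "B = {f \<in> \<A>. poly_act p f = (\<lambda>x. 0)}"
  have "D_stable B"
    unfolding D_stable_def B_def using stableD
    by (auto simp: poly_act_zero_right poly_act_add_right poly_act_scale_right poly_act_D_op D_op_const)
  then interpret B: D_stable_space B by unfold_locales
  have sub: "poly_lt B n \<subseteq> adjoin_x \<A>" for n
  proof -
    have "poly_lt B n \<subseteq> poly_lt \<A> n" unfolding subset_iff poly_lt_iff_sum B_def by blast
    then show ?thesis using poly_lt_subset_adjoin_x by blast
  qed
  have "g \<in> torsion_closure \<A> (adjoin_x \<A>)" if "g \<in> poly_lt B n" for g n
    using that
  proof (induction n arbitrary: g)
    case 0
    then show ?case using D_stableD(2)[OF D_stable_torsion_closure] by simp
  next
    case (Suc n)
    obtain h f where g: "h \<in> poly_lt B n" "f \<in> B" "g = (\<lambda>x. h x + f x * of_real x ^ n)"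
      by (rule poly_lt_SucE[OF Suc.prems])
    obtain l where l: "l \<in> poly_lt B n" "poly_act p g = (\<lambda>x. l x + poly_act p f x * of_real x ^ n)"
      using B.poly_act_poly_lt_Suc[OF g(1,2), of p] g(3) by blast
    have "poly_act p g = l" using l(2) g(2) by (simp add: B_def)
    then have "poly_act p g \<in> torsion_closure \<A> (adjoin_x \<A>)" using Suc.IH[OF l(1)] by simp
    then show ?case
      using torsion_free_quotient[OF D_stable_torsion_closure subset_torsion_closure
          torsion_closure_subset D_divisible_torsion_closure p(1)] sub[of "Suc n"] Suc.prems by blast
  qed
  from this[OF B.monomial_poly_lt] show ?thesis using f p(2) by (simp add: B_def)
qed

text \<open>If p(D) g has degree 0, then p(D) annihilates the leading coefficient of a
  \<open>g\<close> of positive degree. Removing that leading term, itself in the closure, allows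
  induction. The constant coefficient stays free because \<A> is contained in the closure.\<close>

lemma torsion_closure_eq_adjoin_x_fin: "torsion_closure \<A> (adjoin_x \<A>) = adjoin_x_fin \<A>"
proof
  note T = D_stableD[OF D_stable_torsion_closure]
  show "adjoin_x_fin \<A> \<subseteq> torsion_closure \<A> (adjoin_x \<A>)"
  proof
    fix g assume "g \<in> adjoin_x_fin \<A>"
    then obtain n f where f: "\<forall>j\<le>n. f j \<in> \<A>" "\<forall>j\<in>{1..n}. finite (fourier_support (f j))"
      and g: "g = (\<lambda>x. \<Sum>j\<le>n. f j x * of_real x ^ j)"
      by (auto simp: adjoin_x_fin_def)
    have "(\<lambda>x. f j x * of_real x ^ j) \<in> torsion_closure \<A> (adjoin_x \<A>)" if j: "j \<in> {..n}" for j
    proof (cases "j = 0")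
      case True
      then show ?thesis using f(1) subset_torsion_closure by auto
    next
      case False
      then have fin: "finite (fourier_support (f j))" using f(2) j by simp
      have "f j \<in> \<A>" using f(1) j by simp
      then obtain N where "N \<in> \<N>" "f j \<in> Cinf_period N" by (auto simp: \<A>_def)
      then obtain p where "p \<noteq> 0" "poly_act p (f j) = (\<lambda>x. 0)"
        using annihilated_if_finite_fourier_support[OF _ ge_1 fin] by blast
      then show ?thesis using annihilated_monomial_mem_torsion_closure \<open>f j \<in> \<A>\<close> by blast
    qed
    then show "g \<in> torsion_closure \<A> (adjoin_x \<A>)"
      unfolding g by (rule D_stable_sum[OF D_stable_torsion_closure])
  qed
  have "\<exists>f. (\<forall>j\<le>n. f j \<in> \<A>) \<and> (\<forall>j\<in>{1..n}. finite (fourier_support (f j))) \<and>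
      g = (\<lambda>x. \<Sum>j\<le>n. f j x * of_real x ^ j)"
    if "g \<in> torsion_closure \<A> (adjoin_x \<A>)" "g \<in> poly_lt \<A> (Suc n)" for g n
    using that
  proof (induction n arbitrary: g)
    case 0
    obtain h f where "h \<in> poly_lt \<A> 0" "f \<in> \<A>" "g = (\<lambda>x. h x + f x * of_real x ^ 0)"
      by (rule poly_lt_SucE[OF "0.prems"(2)])
    then show ?case by (intro exI[of _ "\<lambda>_. f"]) simp
  next
    case (Suc n)
    obtain h f where g: "h \<in> poly_lt \<A> (Suc n)" "f \<in> \<A>" "g = (\<lambda>x. h x + f x * of_real x ^ Suc n)"
      by (rule poly_lt_SucE[OF Suc.prems(2)])
    obtain p where p: "p \<noteq> 0" "poly_act p g \<in> \<A>"
      using Suc.prems(1) by (auto simp: torsion_closure_def)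
    obtain l where l: "l \<in> poly_lt \<A> (Suc n)"
      "poly_act p g = (\<lambda>x. l x + poly_act p f x * of_real x ^ Suc n)"
      using poly_act_poly_lt_Suc[OF g(1,2), of p] g(3) by blast
    \<comment> \<open>The top index \<open>Suc n\<close> is positive, so elements of \<A> count as
      lower-order terms. This is what excludes the constant coefficient from the finiteness
      condition.\<close>
    have "poly_act p g \<in> poly_lt \<A> (Suc n)"
      using monomial_poly_lt[OF p(2), of 0] poly_lt_mono[of "Suc 0" "Suc n"] by auto
    from D_stable_diff[OF D_stable_poly_lt l(1) this] have "poly_act p f = (\<lambda>x. 0)"
      by (rule poly_lt_top_coeff_zero) (use l(2) g(2) in \<open>simp_all add: poly_act_closed[OF D_stable_\<A>]\<close>)
    then have fin: "finite (fourier_support f)"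
      and "(\<lambda>x. f x * of_real x ^ Suc n) \<in> torsion_closure \<A> (adjoin_x \<A>)"
      using p(1) g(2) finite_fourier_support_if_annihilated annihilated_monomial_mem_torsion_closure by blast+
    from D_stable_diff[OF D_stable_torsion_closure Suc.prems(1) this(2)]
    have "h \<in> torsion_closure \<A> (adjoin_x \<A>)" by (simp add: g(3))
    from Suc.IH[OF this g(1)] obtain F where F: "\<forall>j\<le>n. F j \<in> \<A>"
      "\<forall>j\<in>{1..n}. finite (fourier_support (F j))" "h = (\<lambda>x. \<Sum>j\<le>n. F j x * of_real x ^ j)" by blast
    show ?case
      by (rule exI[of _ "F(Suc n := f)"]) (use F g(2,3) fin in \<open>auto simp: le_Suc_eq\<close>)
  qed
  then show "torsion_closure \<A> (adjoin_x \<A>) \<subseteq> adjoin_x_fin \<A>"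
    using torsion_closure_subset unfolding adjoin_x_fin_def adjoin_x_eq_poly_lt by blast
qed

lemma injective_envelope_adjoin_x_iff:
  "injective_envelope_in U CD \<A> (fun_module (adjoin_x \<A>)) H \<longleftrightarrow> H = adjoin_x_fin \<A>"
  by (simp add: injective_envelope_iff torsion_closure_eq_adjoin_x_fin)

lemma injective_module_adjoin_x: "injective_module U CD (fun_module (adjoin_x \<A>))"
  by (simp add: injective_fun_module_iff D_stable_adjoin_x D_divisible_adjoin_x)

end

section \<open>The two cases T and PT\<close>

interpretation T: period_family "{1}"
  by unfold_locales auto

interpretation PT: period_family "{1..}"
proof
  show "N * M \<in> {1..}" if "N \<in> {1..}" "M \<in> {1..}" for N M :: nat
    using that mult_le_mono[of 1 N 1 M] by simp
qed auto

lemma T_\<A>_eq: "T.\<A> = Cinf_T"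
  unfolding T.\<A>_def Cinf_T_def by simp

lemma PT_\<A>_eq: "PT.\<A> = Cinf_PT"
  unfolding PT.\<A>_def Cinf_PT_def ..

lemma T_frequencies_eq: "T.frequencies = \<int>"
  unfolding T.frequencies_def by simp

lemma PT_frequencies_eq: "PT.frequencies = \<rat>"
proof (intro equalityI subsetI)
  fix a :: complex assume "a \<in> PT.frequencies"
  then obtain N :: nat where N: "N \<ge> 1" "a * of_nat N \<in> \<int>" unfolding PT.frequencies_def by auto
  then have "a * of_nat N / of_nat N \<in> \<rat>" using Ints_subset_Rats by (intro Rats_divide) auto
  then show "a \<in> \<rat>" using N(1) by simp
next
  fix a :: complex assume "a \<in> \<rat>"
  then obtain m n where mn: "n > 0" "a = of_int m / of_int n" by (elim Rats_cases')
  then have "a * of_nat (nat n) = of_int m" by simp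
  then show "a \<in> PT.frequencies"
    using mn(1) unfolding PT.frequencies_def by (intro CollectI bexI[of _ "nat n"]) auto
qed

theorem lemma2p2:
  shows
    \<comment> \<open>(i)\<close>
    "(injective_module TYPE('u) CD (fun_module (adjoin_x Cinf_T))
      \<and> (\<forall>a::complex. a \<notin> \<int> \<longrightarrow>
           bij_betw (\<lambda>f x. D_op f x - a * f x) (adjoin_x Cinf_T) (adjoin_x Cinf_T))
      \<and> (\<forall>a::complex. a \<in> \<int> \<longrightarrow>
           {f \<in> adjoin_x Cinf_T. (\<lambda>x. D_op f x - a * f x) = (\<lambda>x. 0)}
             = {(\<lambda>x. c * exp (\<i> * a * of_real x)) | c. True}))
    \<comment> \<open>(ii)\<close>
   \<and> ((\<exists>!H. injective_envelope_in TYPE('u) CD Cinf_T (fun_module (adjoin_x Cinf_T)) H)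
      \<and> injective_envelope_in TYPE('u) CD Cinf_T (fun_module (adjoin_x Cinf_T))
          (adjoin_x_fin Cinf_T))
    \<comment> \<open>(iii)\<close>
   \<and> (injective_module TYPE('u) CD (fun_module (adjoin_x Cinf_PT))
      \<and> (\<forall>a::complex. a \<notin> \<rat> \<longrightarrow>
           bij_betw (\<lambda>f x. D_op f x - a * f x) (adjoin_x Cinf_PT) (adjoin_x Cinf_PT))
      \<and> (\<forall>a::complex. a \<in> \<rat> \<longrightarrow>
           {f \<in> adjoin_x Cinf_PT. (\<lambda>x. D_op f x - a * f x) = (\<lambda>x. 0)}
             = {(\<lambda>x. c * exp (\<i> * a * of_real x)) | c. True})
      \<and> (\<exists>!H. injective_envelope_in TYPE('u) CD Cinf_PT (fun_module (adjoin_x Cinf_PT)) H)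
      \<and> injective_envelope_in TYPE('u) CD Cinf_PT (fun_module (adjoin_x Cinf_PT))
          (adjoin_x_fin Cinf_PT))"
proof (intro conjI allI impI)
  note T = T_\<A>_eq T_frequencies_eq and PT = PT_\<A>_eq PT_frequencies_eq
  show "injective_module TYPE('u) CD (fun_module (adjoin_x Cinf_T))"
    by (rule T.injective_module_adjoin_x[unfolded T])
  show "bij_betw (\<lambda>f x. D_op f x - a * f x) (adjoin_x Cinf_T) (adjoin_x Cinf_T)" if "a \<notin> \<int>" for a
    using that by (rule T.bij_betw_D_op_minus[unfolded T])
  show "{f \<in> adjoin_x Cinf_T. (\<lambda>x. D_op f x - a * f x) = (\<lambda>x. 0)}
      = {(\<lambda>x. c * exp (\<i> * a * of_real x)) | c. True}" if "a \<in> \<int>" for a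
    using that by (rule T.kernel_D_op_minus_eq[unfolded T])
  show "\<exists>!H. injective_envelope_in TYPE('u) CD Cinf_T (fun_module (adjoin_x Cinf_T)) H"
    "injective_envelope_in TYPE('u) CD Cinf_T (fun_module (adjoin_x Cinf_T)) (adjoin_x_fin Cinf_T)"
    by (simp_all add: T.injective_envelope_adjoin_x_iff[unfolded T])
  show "injective_module TYPE('u) CD (fun_module (adjoin_x Cinf_PT))"
    by (rule PT.injective_module_adjoin_x[unfolded PT])
  show "bij_betw (\<lambda>f x. D_op f x - a * f x) (adjoin_x Cinf_PT) (adjoin_x Cinf_PT)" if "a \<notin> \<rat>" for a
    using that by (rule PT.bij_betw_D_op_minus[unfolded PT])
  show "{f \<in> adjoin_x Cinf_PT. (\<lambda>x. D_op f x - a * f x) = (\<lambda>x. 0)}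
      = {(\<lambda>x. c * exp (\<i> * a * of_real x)) | c. True}" if "a \<in> \<rat>" for a
    using that by (rule PT.kernel_D_op_minus_eq[unfolded PT])
  show "\<exists>!H. injective_envelope_in TYPE('u) CD Cinf_PT (fun_module (adjoin_x Cinf_PT)) H"
    "injective_envelope_in TYPE('u) CD Cinf_PT (fun_module (adjoin_x Cinf_PT)) (adjoin_x_fin Cinf_PT)"
    by (simp_all add: PT.injective_envelope_adjoin_x_iff[unfolded PT])
qed

end
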